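(* Let $q$ be a prime power, let $d\ge2$ be an integer, and let $g$ be a positive integer. Suppose $$q^{d-2}\mid g,\qquad \eta:=\frac{g}{q^{d-2}}\ \text{ divides }\ q^d-1,$$ and define $\rho:=\gcd(\eta,q-1)$. Then there is a modular $g$-Golomb ruler with at least $$q^{d-1}-\frac{q^{d-2}(\eta-\rho)}2$$ marks modulo $$\frac{q^{d-2}(q^d-1)}{g}.$$ Consequently, for every positive integer $$n\le q^{d-1}-\frac{q^{d-2}(\eta-\rho)}2,$$ writing $n=ag+r$ with integers $a,r$ and $0\le r<g$, one has $$G(g,n)\le \frac{q^{d-2}(q^d-1)}{g}-\left\lceil \frac{\frac{q^{d-2}(q^d-1)}{g}+\frac{g a(a-1)}2+ra}{n}\right\rceil.$$
   Context: A finite set $\mathcal{G}\subset\mathbb{Z}$ is a $g$-Golomb ruler if for every positive integer $d$ the number of pairs $(a,c)\in \mathcal{G}^2$ with $c-a=d$ is at most $g$. $G(g,n)$ denotes the minimum possible diameter (largest element minus smallest element) of a $g$-Golomb ruler with exactly $n$ elements (marks). A set $\mathcal{A}$ of residues modulo $N$ is a modular $g$-Golomb ruler modulo $N$ if every nonzero residue modulo $N$ occurs at most $g$ times as a difference $a-a' \pmod N$ with $(a,a')$ an ordered pair of distinct elements of $\mathcal{A}$; its elements are called marks. *)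

theory Defs
  imports Complex_Main "HOL-Number_Theory.Cong" "HOL-Number_Theory.Prime_Powers"
begin

definition golomb_ruler :: "nat \<Rightarrow> int set \<Rightarrow> bool" where
  "golomb_ruler g S \<longleftrightarrow>
     finite S \<and> (\<forall>d>0. card {(a, c). a \<in> S \<and> c \<in> S \<and> c - a = d} \<le> g)"

(* Meaningful for g, n \<ge> 1: then some ruler with n marks exists (for instance the
   powers of 2 form one), so the minimum is attained. For n \<ge> 1 the set S is
   nonempty, so Max S - Min S is its diameter. *)
definition min_diameter :: "nat \<Rightarrow> nat \<Rightarrow> nat" where
  "min_diameter g n =
     (LEAST D. \<exists>S. golomb_ruler g S \<and> card S = n \<and> int D = Max S - Min S)"

(* Residues modulo N are represented by the integers 0, ..., N - 1. *)
definition modular_golomb_ruler :: "nat \<Rightarrow> nat \<Rightarrow> int set \<Rightarrow> bool" where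
  "modular_golomb_ruler g N A \<longleftrightarrow>
     A \<subseteq> {0..<int N} \<and>
     (\<forall>r \<in> {1..<int N}.
        card {(a, a'). a \<in> A \<and> a' \<in> A \<and> a \<noteq> a' \<and> [a - a' = r] (mod int N)} \<le> g)"

end

theory Submission
  imports Defs "HOL-Computational_Algebra.Polynomial"
begin

text \<open>
  Let \<open>F\<close> be the field with \<open>q^d\<close> elements, \<open>K\<close> its subfield with \<open>q\<close> elements and \<open>V\<close> a
  \<open>K\<close>-hyperplane of \<open>F\<close> avoiding \<open>1\<close>. The affine hyperplane \<open>1 + V\<close> lies in the cyclic group \<open>F\<^sup>*\<close>
  and has \<open>q^(d - 1)\<close> elements; a quotient \<open>c\<close> outside \<open>K\<close> occurs at most \<open>q^(d - 2)\<close> times in it, a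
  quotient \<open>c \<noteq> 1\<close> in \<open>K\<close> never. Reducing the discrete logarithms modulo \<open>N = (q^d - 1) / \<eta>\<close> gives the
  modular ruler: a nonzero residue has \<open>\<eta>\<close> lifts, and two elements can collide only if their
  quotient is one of the \<open>\<eta> - \<rho>\<close> elements outside \<open>K\<close> of the subgroup of order \<open>\<eta>\<close>.

  The field is obtained as a quotient of \<open>Z[X]\<close>. With \<open>m = q^d - 1\<close>, take an ideal \<open>I\<close> that contains
  \<open>p\<close> and \<open>X^m - 1\<close> and is maximal among those not containing \<open>u = \<Prod>r. (X^(m/r) - 1)\<close>, where \<open>r\<close> runs
  over the primes dividing \<open>m\<close>. Since \<open>a^(q^d) = a\<close> holds modulo \<open>p\<close> and \<open>X^m - 1\<close>, this ideal is
  prime, and \<open>u \<notin> I\<close> forces \<open>X\<close> to have order exactly \<open>m\<close>.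

  For the diameter bound, the \<open>n\<close> cyclic gaps of an \<open>n\<close>-element subset of the modular ruler add up to
  \<open>N\<close> and each value occurs at most \<open>g\<close> times among them, which bounds the largest gap from below;
  cutting the circle there leaves a ruler.
\<close>

subsection \<open>Submodules and the Frobenius map modulo an ideal\<close>

text \<open>The scalar set \<open>K\<close> is a parameter so that one notion covers ideals
  (\<open>K = UNIV\<close>) and subspaces over the subfield of a quotient field.\<close>

definition submod :: "'a::comm_ring_1 set \<Rightarrow> 'a set \<Rightarrow> bool" where
  "submod K V \<longleftrightarrow> 0 \<in> V \<and> (\<forall>a\<in>V. \<forall>b\<in>V. a + b \<in> V) \<and> (\<forall>k\<in>K. \<forall>a\<in>V. k * a \<in> V)"

lemma submodD:
  assumes "submod K V"
  shows "0 \<in> V" "a \<in> V \<Longrightarrow> b \<in> V \<Longrightarrow> a + b \<in> V" "k \<in> K \<Longrightarrow> a \<in> V \<Longrightarrow> k * a \<in> V"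
  using assms by (auto simp: submod_def)

lemma submod_diff:
  assumes "submod K V" "- 1 \<in> K" "a \<in> V" "b \<in> V"
  shows "a - b \<in> V"
  using submodD(2)[OF assms(1) assms(3) submodD(3)[OF assms(1,2,4)]] by simp

text \<open>Zorn's lemma: if \<open>y\<close> lies outside a maximal \<open>V\<close>, then
  \<open>V + K y\<close> is strictly larger and must contain \<open>u\<close>. It serves twice: with
  \<open>K = UNIV\<close> for the prime ideal, and with \<open>u = 1\<close> over the fixed ring for
  the hyperplane.\<close>

lemma exists_maximal_submod:
  fixes J K :: "'a::comm_ring_1 set"
  assumes J: "submod K J" "u \<notin> J"
    and K: "0 \<in> K" "1 \<in> K" "\<And>a b. a \<in> K \<Longrightarrow> b \<in> K \<Longrightarrow> a + b \<in> K"
      "\<And>a b. a \<in> K \<Longrightarrow> b \<in> K \<Longrightarrow> a * b \<in> K"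
  obtains V where "submod K V" "J \<subseteq> V" "u \<notin> V"
    "\<And>y. y \<notin> V \<Longrightarrow> \<exists>v\<in>V. \<exists>k\<in>K. u = v + k * y"
proof -
  define F where "F = {V. submod K V \<and> J \<subseteq> V \<and> u \<notin> V}"
  have "\<exists>M\<in>F. \<forall>X\<in>F. M \<subseteq> X \<longrightarrow> X = M"
  proof (rule subset_Zorn_nonempty)
    show "F \<noteq> {}" using J by (auto simp: F_def)
    fix C assume C: "C \<noteq> {}" "subset.chain F C"
    have CF: "\<And>V. V \<in> C \<Longrightarrow> submod K V \<and> J \<subseteq> V \<and> u \<notin> V"
      and lin: "\<And>V W. V \<in> C \<Longrightarrow> W \<in> C \<Longrightarrow> V \<subseteq> W \<or> W \<subseteq> V"
      using C(2) by (auto simp: F_def subset_chain_def)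
    have "a + b \<in> \<Union>C" if "a \<in> \<Union>C" "b \<in> \<Union>C" for a b
    proof -
      from that obtain V W where VW: "V \<in> C" "a \<in> V" "W \<in> C" "b \<in> W" by blast
      then obtain X where "X \<in> C" "a \<in> X" "b \<in> X" using lin[of V W] by blast
      then show ?thesis using CF submodD(2) by blast
    qed
    moreover have "0 \<in> \<Union>C" using C(1) CF submodD(1) by blast
    moreover have "k * a \<in> \<Union>C" if "k \<in> K" "a \<in> \<Union>C" for k a
      using that CF submodD(3) by blast
    ultimately have "submod K (\<Union>C)" unfolding submod_def by simp
    then show "\<Union>C \<in> F" using C(1) CF by (auto simp: F_def)
  qed
  then obtain V where V: "submod K V" "J \<subseteq> V" "u \<notin> V" and
    max: "\<And>X. X \<in> F \<Longrightarrow> V \<subseteq> X \<Longrightarrow> X = V"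
    by (auto simp: F_def)
  have "\<exists>v\<in>V. \<exists>k\<in>K. u = v + k * y" if y: "y \<notin> V" for y
  proof (rule ccontr)
    assume neg: "\<not> ?thesis"
    define W where "W = {v + k * y |v k. v \<in> V \<and> k \<in> K}"
    have WI: "v \<in> V \<Longrightarrow> k \<in> K \<Longrightarrow> v + k * y \<in> W" for v k by (auto simp: W_def)
    have VW: "V \<subseteq> W" using WI[OF _ K(1)] by auto
    have "y \<in> W" using WI[OF submodD(1)[OF V(1)] K(2)] by simp
    have "submod K W"
      unfolding submod_def
    proof (intro conjI ballI)
      show "0 \<in> W" using VW submodD(1)[OF V(1)] by auto
      fix a b assume "a \<in> W" "b \<in> W"
      then obtain v k v' k' where *: "a = v + k * y" "b = v' + k' * y" "v \<in> V" "v' \<in> V" "k \<in> K" "k' \<in> K"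
        by (auto simp: W_def)
      have "a + b = (v + v') + (k + k') * y" by (simp add: * algebra_simps)
      also have "\<dots> \<in> W" by (intro WI K(3) submodD(2)[OF V(1)] *)
      finally show "a + b \<in> W" .
    next
      fix l a assume "l \<in> K" "a \<in> W"
      then obtain v k where *: "a = v + k * y" "v \<in> V" "k \<in> K"
        by (auto simp: W_def)
      have "l * a = l * v + (l * k) * y" by (simp add: * algebra_simps)
      also have "\<dots> \<in> W" by (intro WI K(4) submodD(3)[OF V(1)] * \<open>l \<in> K\<close>)
      finally show "l * a \<in> W" .
    qed
    moreover have "u \<notin> W" using neg by (auto simp: W_def)
    ultimately have "W \<in> F" using VW V(2) by (auto simp: F_def)
    then show False using max VW \<open>y \<in> W\<close> y by blast
  qed
  then show thesis using that V by blast
qed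

text \<open>The inner binomial coefficients are multiples of \<open>p\<close>. The induction on
  \<open>k\<close> raises the previous congruence to the \<open>p\<close>-th power, which
  \<open>power_case\<close> permits.\<close>

lemma frobenius_ideal_add:
  fixes I :: "'a::comm_ring_1 set"
  assumes I: "submod UNIV I" and p: "prime p" "of_nat p \<in> I"
  shows "(a + b) ^ (p ^ k) - (a ^ (p ^ k) + b ^ (p ^ k)) \<in> I"
proof -
  have prime_case: "(a + b) ^ p - (a ^ p + b ^ p) \<in> I" for a b
  proof -
    have "p > 0" using p(1) prime_gt_0_nat by blast
    have split: "{..p} = insert 0 (insert p {1..<p})" using \<open>p > 0\<close> by auto
    have "(a + b) ^ p = (\<Sum>k\<le>p. of_nat (p choose k) * a ^ k * b ^ (p - k))"
      by (rule binomial_ring)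
    then have "(a + b) ^ p - (a ^ p + b ^ p) = (\<Sum>k\<in>{1..<p}. of_nat (p choose k) * a ^ k * b ^ (p - k))"
      unfolding split using \<open>p > 0\<close> by (simp add: algebra_simps)
    also have "\<dots> = (\<Sum>k\<in>{1..<p}. of_nat p * (of_nat ((p choose k) div p) * a ^ k * b ^ (p - k)))"
    proof (rule sum.cong[OF refl])
      fix k assume "k \<in> {1..<p}"
      then have "p dvd p choose k" by (intro dvd_choose_prime) (use p in auto)
      then have "of_nat (p choose k) = (of_nat p * of_nat ((p choose k) div p) :: 'a)"
        by (simp flip: of_nat_mult)
      then show "of_nat (p choose k) * a ^ k * b ^ (p - k) =
          of_nat p * (of_nat ((p choose k) div p) * a ^ k * b ^ (p - k))"
        by (simp add: mult.assoc)
    qed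
    also have "\<dots> = (\<Sum>k\<in>{1..<p}. of_nat ((p choose k) div p) * a ^ k * b ^ (p - k)) * of_nat p"
      by (simp add: sum_distrib_left mult.commute)
    also have "\<dots> \<in> I" using submodD(3)[OF I _ p(2)] by simp
    finally show ?thesis .
  qed
  have power_case: "a ^ j - b ^ j \<in> I" if "a - b \<in> I" for a b j
  proof -
    have "a ^ j - b ^ j = (\<Sum>i<j. b ^ (j - Suc i) * a ^ i) * (a - b)"
      by (simp add: power_diff_sumr2 mult.commute)
    then show ?thesis using submodD(3)[OF I UNIV_I that] by simp
  qed
  show ?thesis
  proof (induction k)
    case 0
    then show ?case using submodD(1)[OF I] by simp
  next
    case (Suc k)
    from submodD(2)[OF I power_case[OF Suc] prime_case, of p "a ^ p ^ k" "b ^ p ^ k"]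
    show ?case by (simp only: power_mult[symmetric] power_Suc2 diff_add_cancel add_diff_eq)
  qed
qed

text \<open>\<open>K\<close> is the preimage of the fixed points of a power of Frobenius. The
  exponent \<open>q^d\<close> will show that every class is fixed; the exponent \<open>q\<close>
  will cut out the subfield.\<close>

lemma frobenius_fixed_ring:
  fixes I :: "'a::comm_ring_1 set" and p k :: nat
  assumes I: "submod UNIV I" and p: "prime p" "of_nat p \<in> I"
  defines "K \<equiv> {a. a ^ (p ^ k) - a \<in> I}"
  shows "I \<subseteq> K" "0 \<in> K" "1 \<in> K" "- 1 \<in> K"
    "\<And>a b. a \<in> K \<Longrightarrow> b \<in> K \<Longrightarrow> a + b \<in> K" "\<And>a b. a \<in> K \<Longrightarrow> b \<in> K \<Longrightarrow> a * b \<in> K"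
proof -
  have "p > 0" using p(1) prime_gt_0_nat by blast
  then have pk: "p ^ k > 0" by simp
  note IM = submodD(3)[OF I UNIV_I]
  note ID = submod_diff[OF I UNIV_I]
  show "I \<subseteq> K"
  proof
    fix a assume a: "a \<in> I"
    have "a ^ (p ^ k) = a ^ (p ^ k - 1) * a" using pk by (simp only: power_minus_mult)
    then show "a \<in> K" using ID[OF IM[OF a] a] by (simp add: K_def)
  qed
  show 0: "0 \<in> K" and one: "1 \<in> K" using submodD(1)[OF I] pk by (auto simp: K_def zero_power)
  show add: "a + b \<in> K" if "a \<in> K" "b \<in> K" for a b
  proof -
    have "(a + b) ^ (p ^ k) - (a + b) = ((a + b) ^ (p ^ k) - (a ^ (p ^ k) + b ^ (p ^ k)))
       + ((a ^ (p ^ k) - a) + (b ^ (p ^ k) - b))" by simp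
    also have "\<dots> \<in> I"
      using that by (intro submodD(2)[OF I] frobenius_ideal_add[OF I p]) (auto simp: K_def)
    finally show ?thesis by (simp add: K_def)
  qed
  show "a * b \<in> K" if "a \<in> K" "b \<in> K" for a b
  proof -
    have "(a * b) ^ (p ^ k) - (a * b) = b ^ (p ^ k) * (a ^ (p ^ k) - a) + a * (b ^ (p ^ k) - b)"
      by (simp add: power_mult_distrib algebra_simps)
    also have "\<dots> \<in> I"
      using that by (intro submodD(2)[OF I] IM) (auto simp: K_def)
    finally show ?thesis by (simp add: K_def)
  qed
  have nat: "of_nat n \<in> K" for n using 0 one add by (induction n) auto
  \<comment> \<open>Writing \<open>- 1\<close> as \<open>- p + (p - 1)\<close> treats
    \<open>p = 2\<close> and odd primes alike.\<close>
  have "- of_nat p \<in> K" using \<open>I \<subseteq> K\<close> IM[OF p(2), of "- 1"] by auto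
  from add[OF this nat[of "p - 1"]] show "- 1 \<in> K" using \<open>p > 0\<close> by (simp add: of_nat_diff)
qed

subsection \<open>A finite field as a quotient of the integer polynomials\<close>

text \<open>If \<open>s\<close> were in \<open>B\<close>, the full power of \<open>s\<close> in
  \<open>m\<close> would divide every \<open>m div r\<close> with \<open>r \<noteq> s\<close>, hence
  also \<open>m div s\<close>, which has one factor \<open>s\<close> too few.\<close>

lemma dvd_sum_prime_cofactors:
  fixes m :: nat
  assumes "m > 0" "B \<subseteq> prime_factors m" "m dvd (\<Sum>r\<in>B. m div r)"
  shows "B = {}"
proof (rule ccontr)
  assume "B \<noteq> {}"
  then obtain s where s: "s \<in> B" by blast
  have fin: "finite B" using assms(2) finite_subset by blast
  have sp: "prime s" "s dvd m" using s assms(2) by (auto simp: in_prime_factors_iff)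
  define k where "k = multiplicity s m"
  have sk: "s ^ k dvd m" by (simp add: k_def multiplicity_dvd)
  have "s ^ k dvd m div r" if "r \<in> B - {s}" for r
  proof -
    have r: "prime r" "r dvd m" "r \<noteq> s" using that assms(2) by (auto simp: in_prime_factors_iff)
    have "coprime (s ^ k) r" using sp(1) r by (simp add: primes_coprime)
    moreover have "s ^ k dvd r * (m div r)" using sk r(2) by simp
    ultimately show ?thesis by (simp add: coprime_dvd_mult_right_iff)
  qed
  then have "s ^ k dvd (\<Sum>r\<in>B - {s}. m div r)" by (intro dvd_sum) auto
  moreover have "s ^ k dvd m div s + (\<Sum>r\<in>B - {s}. m div r)"
    using assms(3) sk dvd_trans by (simp add: sum.remove[OF fin s, symmetric])
  ultimately have "s ^ k dvd m div s" using dvd_add_left_iff by blast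
  then have "s ^ k * s dvd m" using sp(2) by (metis dvd_div_mult_self mult_dvd_mono dvd_refl)
  then have "Suc k \<le> multiplicity s m"
    using assms(1) sp(1) by (intro multiplicity_geI) (auto simp: mult.commute prime_nat_iff)
  then show False by (simp add: k_def)
qed

text \<open>The coefficient of the identity of the cyclic group in the image of \<open>f\<close> in the group ring
  \<open>Z[X]/(X^m - 1)\<close>.\<close>

definition const_coeff_mod :: "nat \<Rightarrow> int poly \<Rightarrow> int" where
  "const_coeff_mod m f = (\<Sum>i\<in>{i. i \<le> degree f \<and> m dvd i}. coeff f i)"

section \<open>The identity coefficient as a linear functional on the group ring\<close>

lemma const_coeff_mod_eq:
  assumes "degree f \<le> n"
  shows "const_coeff_mod m f = (\<Sum>i\<in>{i. i \<le> n \<and> m dvd i}. coeff f i)"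
  unfolding const_coeff_mod_def
  by (rule sum.mono_neutral_left) (use assms in \<open>auto intro: le_degree\<close>)

lemma const_coeff_mod_add: "const_coeff_mod m (f + g) = const_coeff_mod m f + const_coeff_mod m g"
proof -
  define n where "n = max (degree f) (degree g)"
  have "degree (f + g) \<le> n" "degree f \<le> n" "degree g \<le> n"
    using degree_add_le_max by (auto simp: n_def)
  then show ?thesis by (simp add: const_coeff_mod_eq sum.distrib)
qed

lemma const_coeff_mod_smult: "const_coeff_mod m (smult c f) = c * const_coeff_mod m f"
proof -
  have "degree (smult c f) \<le> degree f" by (rule degree_smult_le)
  then show ?thesis by (simp add: const_coeff_mod_eq[of _ "degree f"] sum_distrib_left)
qed

lemma const_coeff_mod_monom: "const_coeff_mod m (monom a k) = (if m dvd k then a else 0)"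
proof -
  have "const_coeff_mod m (monom a k) = (\<Sum>i\<in>{i. i \<le> k \<and> m dvd i}. if k = i then a else 0)"
    by (simp add: const_coeff_mod_eq[OF degree_monom_le])
  then show ?thesis by (simp add: sum.delta)
qed

text \<open>Multiplication by \<open>X^m\<close> preserves divisibility of exponents by
  \<open>m\<close>, so the functional descends to the quotient by \<open>X^m - 1\<close>.\<close>

lemma const_coeff_mod_shift: "const_coeff_mod m ((monom 1 m - 1) * f) = 0"
proof -
  have *: "const_coeff_mod m ((monom 1 m - 1) * monom a k) = 0" for a k
  proof -
    have "(monom 1 m - 1) * monom a k = monom a (m + k) + smult (- 1) (monom a k)"
      by (simp add: left_diff_distrib mult_monom)
    then show ?thesis
      by (simp only: const_coeff_mod_add const_coeff_mod_smult const_coeff_mod_monom) simp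
  qed
  have "const_coeff_mod m ((monom 1 m - 1) * (\<Sum>i\<le>n. monom (coeff f i) i)) = 0" for n
    by (induction n) (simp_all add: * distrib_left const_coeff_mod_add)
  from this[of "degree f"] show ?thesis by (simp add: poly_as_sum_of_monoms)
qed

text \<open>In the expanded product every exponent is a sum of \<open>m div r\<close> over a subset
  of the primes. Only the empty subset gives a multiple of \<open>m\<close>, so only the constant
  term survives, a product of factors \<open>- 1\<close>.\<close>

lemma const_coeff_mod_prime_cofactors:
  assumes "m > 0"
  shows "\<bar>const_coeff_mod m (\<Prod>r\<in>prime_factors m. monom 1 (m div r) - 1)\<bar> = 1"
proof -
  define u where "u S = (\<Prod>r\<in>S. monom 1 (m div r) - 1 :: int poly)" for S
  have supp: "\<exists>B\<subseteq>S. i = (\<Sum>r\<in>B. m div r)"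
    if "finite S" "coeff (u S) i \<noteq> 0" for S i
    using that
  proof (induction S arbitrary: i rule: finite_induct)
    case empty
    then show ?case by (auto simp: u_def coeff_1 split: if_splits)
  next
    case (insert s S)
    have "u (insert s S) = monom 1 (m div s) * u S - u S"
      using insert.hyps by (simp add: u_def algebra_simps)
    then have "coeff (u (insert s S)) i =
        (if i < m div s then 0 else coeff (u S) (i - m div s)) - coeff (u S) i"
      by (simp add: coeff_monom_mult)
    then consider "coeff (u S) i \<noteq> 0" | "m div s \<le> i" "coeff (u S) (i - m div s) \<noteq> 0"
      using insert.prems by (cases "coeff (u S) i = 0") (auto split: if_splits)
    then show ?case
    proof cases
      case 1
      then show ?thesis using insert.IH by blast
    next
      case 2
      then obtain B where B: "B \<subseteq> S" "i - m div s = (\<Sum>r\<in>B. m div r)" using insert.IH by blast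
      have "finite B" "s \<notin> B" using B(1) insert.hyps finite_subset by blast+
      then have "i = (\<Sum>r\<in>insert s B. m div r)" using B(2) 2(1) by simp
      then show ?thesis using B(1) by blast
    qed
  qed
  define P where "P = prime_factors m"
  have zero: "coeff (u P) i = 0" if "m dvd i" "i \<noteq> 0" for i
  proof (rule ccontr)
    assume "coeff (u P) i \<noteq> 0"
    then obtain B where "B \<subseteq> P" "i = (\<Sum>r\<in>B. m div r)" using supp[of P i] by (auto simp: P_def)
    then have "B = {}" using dvd_sum_prime_cofactors[of m B] assms that(1) by (simp add: P_def)
    then show False using that(2) \<open>i = _\<close> by simp
  qed
  have "const_coeff_mod m (u P) = (\<Sum>i\<in>{0}. coeff (u P) i)"
    unfolding const_coeff_mod_def by (rule sum.mono_neutral_right) (use zero in auto)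
  also have "\<dots> = poly (u P) 0" by (simp add: poly_0_coeff_0)
  also have "\<dots> = (\<Prod>r\<in>P. - 1)"
    unfolding u_def poly_prod
  proof (rule prod.cong[OF refl])
    fix r assume "r \<in> P"
    then have "m div r > 0" using assms unfolding P_def
      by (metis div_greater_zero_iff dvd_imp_le in_prime_factors_iff prime_gt_0_nat)
    then show "poly (monom 1 (m div r) - 1) 0 = (- 1 :: int)" by (simp add: poly_monom)
  qed
  finally show ?thesis by (simp add: u_def P_def power_abs)
qed

text \<open>The fixed elements are closed under sums and products and contain the integer constants
  as well as \<open>X\<close>, since \<open>X^(p^k) = X * X^(p^k - 1)\<close>; these generate all of
  \<open>Z[X]\<close>.\<close>

lemma int_poly_frobenius_fixed:
  fixes I :: "int poly set"
  assumes I: "submod UNIV I" and p: "prime p" "of_nat p \<in> I"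
    and x: "monom 1 (p ^ k - 1) - 1 \<in> I"
  shows "a ^ (p ^ k) - a \<in> I"
proof -
  define K where "K = {a. a ^ (p ^ k) - a \<in> I}"
  note K = frobenius_fixed_ring[OF I p, where k = k, folded K_def]
  have "p ^ k > 0" using p(1) by (simp add: prime_gt_0_nat)
  then have "monom 1 1 ^ (p ^ k) - monom 1 1 = monom 1 1 * (monom (1::int) (p ^ k - 1) - 1)"
    by (simp add: monom_power right_diff_distrib mult_monom)
  then have X: "monom 1 1 \<in> K" using submodD(3)[OF I UNIV_I x] by (simp add: K_def)
  have nat: "of_nat n \<in> K" for n using K(2,3,5) by (induction n) auto
  have const: "[:c:] \<in> K" for c
  proof (cases "c \<ge> 0")
    case True
    then have "[:c:] = of_nat (nat c)" by (simp add: of_nat_poly)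
    then show ?thesis using nat by metis
  next
    case False
    then have "[:c:] = (- 1) * of_nat (nat (- c))" by (simp add: of_nat_poly)
    then show ?thesis using K(6)[OF K(4) nat] by metis
  qed
  have "a \<in> K"
  proof (induction a rule: pCons_induct)
    case 0
    then show ?case by (rule K(2))
  next
    case (pCons c f)
    have "pCons c f = [:c:] + monom 1 1 * f" by (simp add: monom_altdef)
    then show ?case using K(5)[OF const K(6)[OF X pCons.IH]] by simp
  qed
  then show ?thesis by (simp add: K_def)
qed

section \<open>Powers congruent to one and the residue field\<close>

lemma power_diff_one_in_ideal:
  fixes I :: "'a::comm_ring_1 set"
  assumes "submod UNIV I" "a - 1 \<in> I"
  shows "a ^ n - 1 \<in> I"
  using submodD(3)[OF assms(1) UNIV_I assms(2)] by (metis mult.commute power_diff_1_eq)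

text \<open>Bezout over the naturals: a multiple of \<open>i\<close> equals \<open>gcd i m\<close>
  plus a multiple of \<open>m\<close>. This fails for \<open>i = 0\<close>, where the claim is
  immediate.\<close>

lemma power_gcd_diff_one_in_ideal:
  fixes I :: "'a::comm_ring_1 set"
  assumes I: "submod UNIV I" and "m > 0" "x ^ m - 1 \<in> I" "x ^ i - 1 \<in> I"
  shows "x ^ gcd i m - 1 \<in> I"
proof (cases "i = 0")
  case True
  then show ?thesis using assms by simp
next
  case False
  then obtain a b where ab: "i * a = m * b + gcd i m" using bezout_nat by blast
  have 1: "x ^ (i * a) - 1 \<in> I" "x ^ (m * b) - 1 \<in> I"
    using power_diff_one_in_ideal[OF I] assms(3,4) by (auto simp: power_mult)
  have "x ^ gcd i m - 1 = (x ^ (i * a) - 1) - x ^ gcd i m * (x ^ (m * b) - 1)"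
    unfolding ab by (simp add: power_add algebra_simps)
  then show ?thesis using submod_diff[OF I UNIV_I 1(1) submodD(3)[OF I UNIV_I 1(2)]] by metis
qed

text \<open>The quotient of \<open>Z[X]\<close> by \<open>I\<close> is handled through congruences.
  The last two properties say that the nonzero classes are exactly the powers of \<open>x\<close>,
  with \<open>m\<close> of them distinct.\<close>

lemma exists_cyclic_residue_field:
  fixes p k :: nat
  assumes p: "prime p" and k: "k > 0"
  defines "m \<equiv> p ^ k - 1"
  obtains I :: "int poly set" and x :: "int poly" where
    "submod UNIV I" "1 \<notin> I" "of_nat p \<in> I" "x ^ m - 1 \<in> I"
    "\<And>i. 0 < i \<Longrightarrow> i < m \<Longrightarrow> x ^ i - 1 \<notin> I" "\<And>a. a \<notin> I \<Longrightarrow> \<exists>i<m. a - x ^ i \<in> I"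
proof -
  have p2: "p \<ge> 2" using p prime_ge_2_nat by blast
  have Q2: "p ^ k \<ge> 2" using p2 k self_le_power[of p k] by linarith
  then have m: "m > 0" "p ^ k = Suc m" by (auto simp: m_def)
  define x :: "int poly" where "x = monom 1 1"
  have xpow: "x ^ i = monom 1 i" for i by (simp add: x_def monom_power)
  define J :: "int poly set" where "J = {a * of_nat p + b * (x ^ m - 1) |a b. True}"
  define u :: "int poly" where "u = (\<Prod>r\<in>prime_factors m. x ^ (m div r) - 1)"
  have J: "submod UNIV J"
    unfolding submod_def
  proof (intro conjI ballI)
    show "0 \<in> J" by (auto simp: J_def intro!: exI[of _ 0])
    fix a b assume "a \<in> J" "b \<in> J"
    then obtain a1 a2 b1 b2 where "a = a1 * of_nat p + a2 * (x ^ m - 1)" "b = b1 * of_nat p + b2 * (x ^ m - 1)"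
      by (auto simp: J_def)
    then have "a + b = (a1 + b1) * of_nat p + (a2 + b2) * (x ^ m - 1)" by (simp add: algebra_simps)
    then show "a + b \<in> J" unfolding J_def by blast
  next
    fix c a assume "a \<in> J"
    then obtain a1 a2 where a: "a = a1 * of_nat p + a2 * (x ^ m - 1)" by (auto simp: J_def)
    have "c * a = (c * a1) * of_nat p + (c * a2) * (x ^ m - 1)" unfolding a by (simp add: algebra_simps)
    then show "c * a \<in> J" unfolding J_def by blast
  qed
  have "1 * of_nat p + 0 * (x ^ m - 1) \<in> J" "0 * of_nat p + 1 * (x ^ m - 1) \<in> J"
    unfolding J_def by blast+
  then have pJ: "of_nat p \<in> J" and xJ: "x ^ m - 1 \<in> J" by simp_all
  \<comment> \<open>Modulo \<open>X^m - 1\<close> an element of \<open>J\<close> is a multiple of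
    \<open>p\<close>, so its identity coefficient is divisible by \<open>p\<close>, whereas that of
    \<open>u\<close> is 1 or -1.\<close>
  have uJ: "u \<notin> J"
  proof
    assume "u \<in> J"
    then obtain a b where "u = a * of_nat p + b * (x ^ m - 1)" by (auto simp: J_def)
    then have "u = smult (int p) a + (monom 1 m - 1) * b"
      by (simp add: xpow of_nat_poly mult.commute)
    then have "const_coeff_mod m u = int p * const_coeff_mod m a"
      by (simp add: const_coeff_mod_add const_coeff_mod_smult const_coeff_mod_shift)
    moreover have "\<bar>const_coeff_mod m u\<bar> = 1"
      unfolding u_def xpow by (rule const_coeff_mod_prime_cofactors[OF m(1)])
    ultimately have "int p dvd 1" by (metis dvd_abs_iff dvd_triv_left)
    then show False using p2 by simp
  qed
  obtain I where I: "submod UNIV I" "J \<subseteq> I" "u \<notin> I"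
    and max: "\<And>y. y \<notin> I \<Longrightarrow> \<exists>v\<in>I. \<exists>k\<in>UNIV. u = v + k * y"
    by (rule exists_maximal_submod[OF J uJ]) blast+
  note IA = submodD(2)[OF I(1)] and IM = submodD(3)[OF I(1) UNIV_I] and ID = submod_diff[OF I(1) UNIV_I]
  have pI: "of_nat p \<in> I" and xI: "x ^ m - 1 \<in> I" using pJ xJ I(2) by auto
  have frob: "a ^ (p ^ k) - a \<in> I" for a
    using int_poly_frobenius_fixed[OF I(1) p pI] xI by (simp add: xpow m_def)
  \<comment> \<open>If neither factor is in \<open>I\<close>, maximality makes \<open>u\<close>
    congruent to multiples of \<open>a\<close> and of \<open>b\<close>, so \<open>u * u\<close> lies
    in \<open>I\<close>. Then so does \<open>u ^ (p ^ k)\<close>, which is congruent to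
    \<open>u\<close>.\<close>
  have prime: "a \<in> I \<or> b \<in> I" if "a * b \<in> I" for a b
  proof (rule ccontr)
    assume "\<not> ?thesis"
    then obtain v c w l where *: "v \<in> I" "u = v + c * a" "w \<in> I" "u = w + l * b"
      using max by blast
    have "u * u = (v + c * a) * (w + l * b)" using * by metis
    also have "\<dots> = w * v + ((l * b) * v + ((c * a) * w + (c * l) * (a * b)))" by (simp add: algebra_simps)
    also have "\<dots> \<in> I" by (intro IA IM[OF *(1)] IM[OF *(3)] IM[OF that])
    finally have "u ^ (p ^ k - 2) * (u * u) \<in> I" by (rule IM)
    moreover have "u ^ (p ^ k - 2) * (u * u) = u ^ (p ^ k)"
      using Q2 by (metis le_add_diff_inverse2 power2_eq_square power_add)
    ultimately have "u ^ (p ^ k) \<in> I" by simp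
    from ID[OF this frob[of u]] show False using I(3) by simp
  qed
  have one: "1 \<notin> I" using IM[of 1 u] I(3) by auto
  \<comment> \<open>With \<open>e = gcd i m\<close> a proper divisor of \<open>m\<close>, pick a
    prime \<open>r\<close> dividing \<open>m / e\<close>. Then \<open>e\<close> divides
    \<open>m div r\<close>, so a factor of \<open>u\<close> lies in \<open>I\<close>.\<close>
  have order: "x ^ i - 1 \<notin> I" if i: "0 < i" "i < m" for i
  proof
    assume "x ^ i - 1 \<in> I"
    define e where "e = gcd i m"
    have e: "x ^ e - 1 \<in> I"
      unfolding e_def by (rule power_gcd_diff_one_in_ideal[OF I(1) m(1) xI]) fact
    have "e dvd m" "e < m" using i by (auto simp: e_def intro: le_less_trans[OF gcd_le1_nat])
    then obtain f where f: "m = e * f" "f \<noteq> 1" by auto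
    then obtain r where r: "prime r" "r dvd f" using prime_factor_nat by blast
    then obtain h where h: "f = r * h" by auto
    have "r \<in> prime_factors m" using r f m(1) by (auto simp: in_prime_factors_iff)
    moreover have "m div r = e * h" using f h r(1) by (simp add: prime_gt_0_nat)
    then have "x ^ (m div r) - 1 \<in> I"
      using power_diff_one_in_ideal[OF I(1) e] by (simp add: power_mult)
    ultimately have "u \<in> I"
      unfolding u_def by (subst prod.remove[of _ r]) (auto simp: mult.commute[of "x ^ (m div r) - 1"] intro: IM)
    then show False using I(3) by blast
  qed
  have sumI: "(\<And>i. i \<in> A \<Longrightarrow> f i \<in> I) \<Longrightarrow> sum f A \<in> I" for f :: "nat \<Rightarrow> int poly" and A
    by (induction A rule: infinite_finite_induct) (use submodD(1)[OF I(1)] IA in auto)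
  have cover: "\<exists>i<m. a - x ^ i \<in> I" if a: "a \<notin> I" for a
  proof -
    have "a * (a ^ m - 1) \<in> I" using frob[of a] by (simp add: m(2) algebra_simps)
    then have am: "a ^ m - 1 \<in> I" using prime a by blast
    have "\<exists>i<m. a * x ^ i - 1 \<in> I"
    proof (rule ccontr)
      txt \<open>Otherwise the geometric sums \<open>\<Sum>j<m. (a * x ^ i) ^ j\<close> all vanish modulo \<open>I\<close>, although by
        orthogonality they add up to \<open>m\<close>, which is \<open>- 1\<close> modulo \<open>p\<close>.\<close>
      assume neg: "\<not> ?thesis"
      have inner: "(\<Sum>j<m. (a * x ^ i) ^ j) \<in> I" if "i < m" for i
      proof -
        have "(a * x ^ i) ^ m - 1 = a ^ m * ((x ^ m) ^ i - 1) + (a ^ m - 1)"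
          by (simp add: power_mult_distrib power_mult[symmetric] mult.commute algebra_simps)
        also have "\<dots> \<in> I" by (intro IA IM am power_diff_one_in_ideal[OF I(1)] xI)
        finally have "(a * x ^ i - 1) * (\<Sum>j<m. (a * x ^ i) ^ j) \<in> I" by (simp add: power_diff_1_eq)
        then show ?thesis using prime neg that by blast
      qed
      have "(\<Sum>i<m. \<Sum>j<m. (a * x ^ i) ^ j) \<in> I"
        by (rule sumI) (use inner in simp)
      also have "(\<Sum>i<m. \<Sum>j<m. (a * x ^ i) ^ j) = (\<Sum>j<m. \<Sum>i<m. (a * x ^ i) ^ j)"
        by (rule sum.swap)
      also have "\<dots> = (\<Sum>j<m. a ^ j * (\<Sum>i<m. (x ^ j) ^ i))"
        by (simp add: sum_distrib_left power_mult_distrib power_mult[symmetric] mult.commute)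
      also have "\<dots> = of_nat m + (\<Sum>j\<in>{..<m} - {0}. a ^ j * (\<Sum>i<m. (x ^ j) ^ i))"
        using m(1) by (subst sum.remove[of _ 0]) auto
      finally have S: "of_nat m + (\<Sum>j\<in>{..<m} - {0}. a ^ j * (\<Sum>i<m. (x ^ j) ^ i)) \<in> I" .
      have inner: "(\<Sum>i<m. (x ^ j) ^ i) \<in> I" if j: "0 < j" "j < m" for j
      proof -
        have "(x ^ m) ^ j = (x ^ j) ^ m" by (simp only: power_mult[symmetric] mult.commute)
        then have "(x ^ j - 1) * (\<Sum>i<m. (x ^ j) ^ i) = (x ^ m) ^ j - 1"
          by (simp only: power_diff_1_eq)
        then have "(x ^ j - 1) * (\<Sum>i<m. (x ^ j) ^ i) \<in> I"
          using power_diff_one_in_ideal[OF I(1) xI] by simp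
        then show ?thesis using prime order[OF j] by blast
      qed
      have "(\<Sum>j\<in>{..<m} - {0}. a ^ j * (\<Sum>i<m. (x ^ j) ^ i)) \<in> I"
        by (rule sumI, rule IM) (use inner in simp)
      with S have "of_nat m \<in> I" using ID by fastforce
      have "of_nat (p ^ (k - 1)) * of_nat p \<in> I" using IM pI by blast
      moreover have "p ^ (k - 1) * p = Suc m" using m(2) k by (metis power_minus_mult)
      ultimately have "of_nat (Suc m) \<in> I" by (metis of_nat_mult)
      then have "of_nat (Suc m) - of_nat m \<in> I" using ID \<open>of_nat m \<in> I\<close> by blast
      then show False using one by simp
    qed
    then obtain i where i: "i < m" "a * x ^ i - 1 \<in> I" by blast
    \<comment> \<open>\<open>j\<close> represents \<open>- i\<close> modulo \<open>m\<close>; the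
      case split keeps it below \<open>m\<close>.\<close>
    define j where "j = (if i = 0 then 0 else m - i)"
    have xj: "x ^ (i + j) - 1 \<in> I" using xI i submodD(1)[OF I(1)] by (auto simp: j_def)
    have "a - x ^ j = x ^ j * (a * x ^ i - 1) - a * (x ^ (i + j) - 1)"
      by (simp add: power_add algebra_simps)
    then have "a - x ^ j \<in> I" using ID IM i(2) xj by metis
    moreover have "j < m" using i m by (auto simp: j_def)
    ultimately show ?thesis by blast
  qed
  show thesis by (rule that[OF I(1) one pI xI order cover])
qed

subsection \<open>An affine hyperplane in the cyclic multiplicative group\<close>

text \<open>The choice depends only on the coset of \<open>a\<close>, so cosets can be counted as
  the image of a set under \<open>coset_rep I\<close>.\<close>

definition coset_rep :: "'a::comm_ring_1 set \<Rightarrow> 'a \<Rightarrow> 'a" where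
  "coset_rep I a = (SOME b. b - a \<in> I)"

lemma coset_rep:
  assumes "submod UNIV I"
  shows "coset_rep I a - a \<in> I"
  unfolding coset_rep_def
  by (rule someI[of _ a]) (use submodD(1)[OF assms] in simp)

lemma coset_rep_eq_iff:
  assumes I: "submod UNIV I"
  shows "coset_rep I a = coset_rep I b \<longleftrightarrow> a - b \<in> I"
proof
  note ID = submod_diff[OF I UNIV_I]
  have "a - b = (coset_rep I b - b) - (coset_rep I b - a)" by simp
  then show "a - b \<in> I" if "coset_rep I a = coset_rep I b"
    using ID[OF coset_rep[OF I, of b] coset_rep[OF I, of a]] that by simp
  assume ab: "a - b \<in> I"
  have "c - a \<in> I \<longleftrightarrow> c - b \<in> I" for c
    using submodD(2)[OF I, of "c - a" "a - b"] ID[of "c - b" "a - b"] ab by auto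
  then show "coset_rep I a = coset_rep I b" by (simp add: coset_rep_def)
qed

locale cyclic_residue_field =
  fixes I :: "'a::comm_ring_1 set" and x :: 'a and m :: nat
  assumes I: "submod UNIV I" and one_notin: "1 \<notin> I" and m_pos: "m > 0"
    and x_pow_m: "x ^ m - 1 \<in> I"
    and x_order: "\<And>i. 0 < i \<Longrightarrow> i < m \<Longrightarrow> x ^ i - 1 \<notin> I"
    and x_cover: "\<And>a. a \<notin> I \<Longrightarrow> \<exists>i<m. a - x ^ i \<in> I"
begin

abbreviation "rep \<equiv> coset_rep I"

lemmas I_zero = submodD(1)[OF I]
  and I_add = submodD(2)[OF I]
  and I_mult = submodD(3)[OF I UNIV_I]
  and I_diff = submod_diff[OF I UNIV_I]
  and rep = coset_rep[OF I]
  and rep_eq_iff = coset_rep_eq_iff[OF I]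

lemma rep_rep: "rep (rep a) = rep a"
  using rep rep_eq_iff by blast

lemma I_minus: "a - b \<in> I \<Longrightarrow> b - a \<in> I"
  using I_mult[of "a - b" "- 1"] by simp

section \<open>Powers of the generator and counting of cosets\<close>

lemma x_pow_eq_one_iff: "x ^ i - 1 \<in> I \<longleftrightarrow> m dvd i"
proof
  assume "x ^ i - 1 \<in> I"
  then have "x ^ gcd i m - 1 \<in> I"
    by (rule power_gcd_diff_one_in_ideal[OF I m_pos x_pow_m])
  moreover have "0 < gcd i m" using m_pos by simp
  ultimately have "\<not> gcd i m < m" using x_order by blast
  then have "gcd i m = m" using m_pos gcd_le2_nat[of m i] by linarith
  then show "m dvd i" by (metis gcd_dvd1)
next
  assume "m dvd i"
  then obtain j where "i = m * j" by blast
  then show "x ^ i - 1 \<in> I"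
    using power_diff_one_in_ideal[OF I x_pow_m] by (simp add: power_mult)
qed

lemma x_pow_notin: "x ^ i \<notin> I"
proof
  assume "x ^ i \<in> I"
  then have "x ^ (m * i - i) * x ^ i - (x ^ (m * i) - 1) \<in> I"
    using I_mult I_diff x_pow_eq_one_iff[of "m * i"] by simp
  moreover have "m * i - i + i = m * i" using m_pos by simp
  ultimately show False using one_notin by (simp add: power_add[symmetric])
qed

lemma power_m:
  assumes "a \<notin> I" shows "a ^ m - 1 \<in> I"
proof -
  obtain i where i: "a - x ^ i \<in> I" using x_cover assms by blast
  have "a ^ m - (x ^ i) ^ m \<in> I"
    using I_mult[OF i, of "\<Sum>j<m. (x ^ i) ^ (m - Suc j) * a ^ j"]
    by (simp only: power_diff_sumr2 mult.commute)
  moreover have "(x ^ i) ^ m - 1 \<in> I" using x_pow_eq_one_iff[of "i * m"] by (simp add: power_mult)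
  ultimately show ?thesis using I_add by fastforce
qed

text \<open>\<open>a ^ (m - 1)\<close> is an inverse of \<open>a\<close> modulo
  \<open>I\<close>.\<close>

lemma mult_cancel:
  assumes "a * b \<in> I" "a \<notin> I" shows "b \<in> I"
proof -
  have "a ^ (m - 1) * (a * b) = a ^ m * b"
    by (simp only: mult.assoc[symmetric] power_minus_mult[OF m_pos])
  then have "b = a ^ (m - 1) * (a * b) - b * (a ^ m - 1)"
    by (simp add: right_diff_distrib mult.commute)
  then show ?thesis using I_diff I_mult assms(1) power_m[OF assms(2)] by metis
qed

lemma x_pow_cong_iff: "x ^ i - x ^ j \<in> I \<longleftrightarrow> i mod m = j mod m"
proof -
  have *: "x ^ i - x ^ j \<in> I \<longleftrightarrow> i mod m = j mod m" if "j \<le> i" for i j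
  proof -
    have "x ^ i - x ^ j = x ^ j * (x ^ (i - j) - 1)"
      using that by (simp add: right_diff_distrib power_add[symmetric])
    then have "x ^ i - x ^ j \<in> I \<longleftrightarrow> x ^ (i - j) - 1 \<in> I"
      using I_mult mult_cancel x_pow_notin by metis
    also have "\<dots> \<longleftrightarrow> m dvd i - j" by (rule x_pow_eq_one_iff)
    also have "\<dots> \<longleftrightarrow> i mod m = j mod m" using that by (metis mod_eq_dvd_iff_nat)
    finally show ?thesis .
  qed
  show ?thesis
    using *[of i j] *[of j i] I_minus[of "x ^ i" "x ^ j"] I_minus[of "x ^ j" "x ^ i"]
    by (metis nat_le_linear)
qed

lemma rep_image_eq:
  assumes "I \<subseteq> S" "\<And>a b. a \<in> S \<Longrightarrow> b - a \<in> I \<Longrightarrow> b \<in> S"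
  shows "rep ` S = insert (rep 0) ((\<lambda>i. rep (x ^ i)) ` {i. i < m \<and> x ^ i \<in> S})"
proof -
  have "rep a \<in> insert (rep 0) ((\<lambda>i. rep (x ^ i)) ` {i. i < m \<and> x ^ i \<in> S})" if a: "a \<in> S" for a
  proof (cases "a \<in> I")
    case True
    then show ?thesis using rep_eq_iff[of a 0] by simp
  next
    case False
    then obtain i where i: "i < m" "a - x ^ i \<in> I" using x_cover by blast
    then have "x ^ i \<in> S" using assms(2)[OF a I_minus] by blast
    then show ?thesis using i rep_eq_iff by blast
  qed
  then show ?thesis using assms(1) I_zero by blast
qed

text \<open>A union of cosets containing \<open>I\<close> consists of the zero class, which accounts
  for \<open>Suc\<close>, and of classes of powers of \<open>x\<close> with distinct exponents below
  \<open>m\<close>.\<close>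

lemma card_rep_image:
  assumes "I \<subseteq> S" "\<And>a b. a \<in> S \<Longrightarrow> b - a \<in> I \<Longrightarrow> b \<in> S"
  shows "card (rep ` S) = Suc (card {i. i < m \<and> x ^ i \<in> S})"
proof -
  have "rep 0 \<notin> (\<lambda>i. rep (x ^ i)) ` {i. i < m \<and> x ^ i \<in> S}"
  proof
    assume "rep 0 \<in> (\<lambda>i. rep (x ^ i)) ` {i. i < m \<and> x ^ i \<in> S}"
    then obtain i where "rep 0 = rep (x ^ i)" by blast
    then have "x ^ i - 0 \<in> I" using rep_eq_iff[of "x ^ i" 0] by simp
    then show False using x_pow_notin by simp
  qed
  moreover have "inj_on (\<lambda>i. rep (x ^ i)) {i. i < m \<and> x ^ i \<in> S}"
    by (auto simp: inj_on_def rep_eq_iff x_pow_cong_iff)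
  ultimately show ?thesis
    using rep_image_eq[OF assms] by (simp add: card_image)
qed

lemma finite_rep_image: "finite (rep ` S)"
proof (rule finite_subset)
  show "rep ` S \<subseteq> rep ` UNIV" by blast
  show "finite (rep ` UNIV)" by (subst rep_image_eq) auto
qed

lemma card_rep_UNIV: "card (range rep) = Suc m"
  by (subst card_rep_image) auto

end

text \<open>Modulo \<open>I\<close>, \<open>K\<close> is the subfield with \<open>q\<close> elements
  and \<open>V\<close> a \<open>K\<close>-subspace maximal among those avoiding 1.
  \<open>V_max\<close> has the shape delivered by \<open>exists_maximal_submod\<close> for
  \<open>u = 1\<close>.\<close>

locale residue_subfield = cyclic_residue_field +
  fixes q :: nat and K V
  assumes q: "q > 1" "q - 1 dvd m"
    and K_def: "K = {a. a ^ q - a \<in> I}"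
    and K: "I \<subseteq> K" "0 \<in> K" "1 \<in> K" "- 1 \<in> K"
      "\<And>a b. a \<in> K \<Longrightarrow> b \<in> K \<Longrightarrow> a + b \<in> K" "\<And>a b. a \<in> K \<Longrightarrow> b \<in> K \<Longrightarrow> a * b \<in> K"
    and V: "submod K V" "I \<subseteq> V" "1 \<notin> V"
    and V_max: "\<And>y. y \<notin> V \<Longrightarrow> \<exists>v\<in>V. \<exists>k\<in>K. 1 = v + k * y"
begin

lemmas V_add = submodD(2)[OF V(1)]
  and V_mult = submodD(3)[OF V(1)]
  and V_diff = submod_diff[OF V(1) K(4)]

lemma K_diff: "a \<in> K \<Longrightarrow> b \<in> K \<Longrightarrow> a - b \<in> K"
  using K(5)[of a "- 1 * b"] K(6)[OF K(4), of b] by simp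

lemma K_power: "a \<in> K \<Longrightarrow> a ^ n \<in> K"
  by (induction n) (use K(3,6) in auto)

lemma K_saturated: "a \<in> K \<Longrightarrow> b - a \<in> I \<Longrightarrow> b \<in> K"
  using K(5)[of a "b - a"] K(1) by auto

lemma V_saturated: "a \<in> V \<Longrightarrow> b - a \<in> I \<Longrightarrow> b \<in> V"
  using V_add[of a "b - a"] V(2) by auto

lemma K_inverse:
  assumes "a \<in> K" "a \<notin> I"
  obtains b where "b \<in> K" "b * a - 1 \<in> I"
  using that[OF K_power[OF assms(1), of "m - 1"]] power_m[OF assms(2)]
  by (simp only: power_minus_mult[OF m_pos])

text \<open>A nonzero class of \<open>K\<close> has its inverse in \<open>K\<close>; if it also lay
  in \<open>V\<close>, scaling would put 1 into \<open>V\<close>.\<close>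

lemma K_Int_V: "k \<in> K \<Longrightarrow> k \<in> V \<Longrightarrow> k \<in> I"
proof (rule ccontr)
  assume k: "k \<in> K" "k \<in> V" "k \<notin> I"
  then obtain b where b: "b \<in> K" "b * k - 1 \<in> I" using K_inverse by blast
  have "b * k - (b * k - 1) \<in> V" using V_diff V_mult[OF b(1) k(2)] V(2) b(2) by blast
  then show False using V(3) by simp
qed

text \<open>For \<open>y\<close> outside \<open>V\<close>, dividing \<open>1 = v + k * y\<close> by
  \<open>k\<close> shows that \<open>y\<close> is congruent to the inverse of \<open>k\<close>
  modulo \<open>V\<close>. With \<open>K_Int_V\<close> the field is the direct sum of
  \<open>K\<close> and \<open>V\<close>.\<close>

lemma decompose: "\<exists>k\<in>K. y - k \<in> V"
proof (cases "y \<in> V")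
  case True
  then show ?thesis using K(2) by (intro bexI[of _ 0]) auto
next
  case False
  then obtain v k where vk: "v \<in> V" "k \<in> K" "1 = v + k * y" using V_max by blast
  have "k \<notin> I"
  proof
    assume "k \<in> I"
    then have "k * y \<in> V" using I_mult[of k y] V(2) by (auto simp: mult.commute)
    then have "v + k * y \<in> V" using V_add vk(1) by blast
    then show False using vk(3) V(3) by simp
  qed
  then obtain b where b: "b \<in> K" "b * k - 1 \<in> I" using K_inverse vk(2) by blast
  have v: "v = 1 - k * y" using vk(3) by (simp add: eq_diff_eq)
  have "y - b = - 1 * (b * v) - y * (b * k - 1)" unfolding v by (simp add: algebra_simps)
  also have "\<dots> \<in> V"
    using V_diff[OF V_mult[OF K(4) V_mult[OF b(1) vk(1)]]] I_mult[OF b(2)] V(2) by blast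
  finally show ?thesis using b(1) by blast
qed

lemma x_pow_in_K_iff: "x ^ i \<in> K \<longleftrightarrow> m dvd i * (q - 1)"
proof -
  have "(x ^ i) ^ q - x ^ i = x ^ (i * q) - x ^ i" by (simp add: power_mult)
  also have "i * q = i + i * (q - 1)" using q(1) by (simp add: algebra_simps)
  finally have "(x ^ i) ^ q - x ^ i = x ^ i * (x ^ (i * (q - 1)) - 1)"
    by (simp add: power_add right_diff_distrib)
  then have "x ^ i \<in> K \<longleftrightarrow> x ^ i * (x ^ (i * (q - 1)) - 1) \<in> I" by (simp add: K_def)
  also have "\<dots> \<longleftrightarrow> x ^ (i * (q - 1)) - 1 \<in> I"
    using I_mult mult_cancel[OF _ x_pow_notin] by blast
  finally show ?thesis by (simp add: x_pow_eq_one_iff)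
qed

lemma card_rep_K: "card (rep ` K) = q"
proof -
  obtain M where M: "m = (q - 1) * M" using q(2) by blast
  then have M0: "M > 0" using m_pos by simp
  \<comment> \<open>The nonzero classes of \<open>K\<close> form the subgroup of order
    \<open>q - 1\<close>, generated by \<open>x ^ M\<close>.\<close>
  have "{i. i < m \<and> x ^ i \<in> K} = (\<lambda>j. M * j) ` {..<q - 1}"
  proof (intro set_eqI iffI)
    fix i assume "i \<in> {i. i < m \<and> x ^ i \<in> K}"
    then have i: "i < m" "m dvd i * (q - 1)" by (auto simp: x_pow_in_K_iff)
    then have "M dvd i" using q(1) unfolding M by (simp add: mult.commute)
    then obtain j where "i = M * j" by blast
    moreover have "j < q - 1" using i(1) unfolding M \<open>i = M * j\<close> by simp
    ultimately show "i \<in> (\<lambda>j. M * j) ` {..<q - 1}" by blast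
  next
    fix i assume "i \<in> (\<lambda>j. M * j) ` {..<q - 1}"
    then obtain j where j: "j < q - 1" "i = M * j" by blast
    have "i < m" using j M0 unfolding M by simp
    moreover have "m dvd i * (q - 1)" unfolding M j(2) by (simp add: ac_simps)
    ultimately show "i \<in> {i. i < m \<and> x ^ i \<in> K}" by (simp add: x_pow_in_K_iff)
  qed
  moreover have "inj_on (\<lambda>j. M * j) {..<q - 1}" using M0 by (auto simp: inj_on_def)
  ultimately have "card {i. i < m \<and> x ^ i \<in> K} = q - 1" by (simp add: card_image)
  then show ?thesis using card_rep_image[OF K(1) K_saturated] q(1) by simp
qed

lemma card_rep_V: "card (rep ` V) * q = Suc m"
proof -
  have "bij_betw (\<lambda>(v, k). rep (v + k)) (rep ` V \<times> rep ` K) (range rep)"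
    unfolding bij_betw_def
  proof
    show "inj_on (\<lambda>(v, k). rep (v + k)) (rep ` V \<times> rep ` K)"
    proof (rule inj_onI, clarsimp)
      fix v k v' k' assume *: "v \<in> V" "k \<in> K" "v' \<in> V" "k' \<in> K"
        and eq: "rep (rep v + rep k) = rep (rep v' + rep k')"
      define a b c d where abcd: "a = rep v" "b = rep k" "c = rep v'" "d = rep k'"
      have in_sets: "a \<in> V" "b \<in> K" "c \<in> V" "d \<in> K"
        using * rep K_saturated V_saturated by (auto simp: abcd)
      have sum: "a + b - (c + d) \<in> I" using eq by (simp add: rep_eq_iff abcd)
      have "b - d = (a + b - (c + d)) - (a - c)" by simp
      also have "\<dots> \<in> V" using V_diff[OF subsetD[OF V(2) sum] V_diff[OF in_sets(1,3)]] .
      finally have bd: "b - d \<in> I" using K_Int_V K_diff in_sets by blast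
      have "a - c = (a + b - (c + d)) - (b - d)" by simp
      also have "\<dots> \<in> I" using sum bd by (rule I_diff)
      finally have ac: "a - c \<in> I" .
      show "rep v = rep v' \<and> rep k = rep k'"
        using ac bd rep_eq_iff rep_rep unfolding abcd by metis
    qed
    have "rep y \<in> (\<lambda>(v, k). rep (v + k)) ` (rep ` V \<times> rep ` K)" for y
    proof -
      obtain k where k: "k \<in> K" "y - k \<in> V" using decompose by blast
      have "rep (y - k) + rep k - y = (rep (y - k) - (y - k)) + (rep k - k)" by simp
      also have "\<dots> \<in> I" by (intro I_add rep)
      finally have "rep (rep (y - k) + rep k) = rep y" by (simp add: rep_eq_iff)
      then show ?thesis using k by force
    qed
    then show "(\<lambda>(v, k). rep (v + k)) ` (rep ` V \<times> rep ` K) = range rep" by auto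
  qed
  then have "card (rep ` V \<times> rep ` K) = Suc m" using bij_betw_same_card card_rep_UNIV by metis
  then show ?thesis by (simp add: card_cartesian_product card_rep_K)
qed

text \<open>The classical affine relative difference set: the discrete logarithms to the base
  \<open>x\<close> of \<open>1 + V\<close>, with the nonzero classes of \<open>K\<close> as
  forbidden subgroup.\<close>

definition hyperplane_logs :: "nat set" where
  "hyperplane_logs = {i. i < m \<and> x ^ i - 1 \<in> V}"

lemma card_rep_affine: "card (rep ` {a. a - 1 \<in> V}) = card (rep ` V)"
proof -
  have "bij_betw (\<lambda>a. rep (a - 1)) (rep ` {a. a - 1 \<in> V}) (rep ` V)"
    unfolding bij_betw_def
  proof
    have *: "rep (rep a - 1) = rep (a - 1)" for a
      using rep[of a] by (simp add: rep_eq_iff)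
    show "inj_on (\<lambda>a. rep (a - 1)) (rep ` {a. a - 1 \<in> V})"
    proof (rule inj_onI, clarsimp)
      fix a b assume "rep (rep a - 1) = rep (rep b - 1)"
      then show "rep a = rep b" unfolding * by (simp add: rep_eq_iff)
    qed
    have "rep v \<in> (\<lambda>a. rep (a - 1)) ` rep ` {a. a - 1 \<in> V}" if "v \<in> V" for v
      using *[of "v + 1"] that by (intro image_eqI[of _ _ "rep (v + 1)"] imageI) auto
    then show "(\<lambda>a. rep (a - 1)) ` rep ` {a. a - 1 \<in> V} = rep ` V"
      using * by auto
  qed
  then show ?thesis by (rule bij_betw_same_card)
qed

lemma affine_saturated: "a - 1 \<in> V \<Longrightarrow> b - a \<in> I \<Longrightarrow> b - 1 \<in> V"
  using V_saturated[of "a - 1" "b - 1"] by simp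

text \<open>No element of \<open>1 + V\<close> lies in \<open>I\<close>, because 1 is not in
  \<open>V\<close>; hence each one has a logarithm.\<close>

lemma card_hyperplane_logs: "card hyperplane_logs = card (rep ` V)"
proof -
  have "bij_betw (\<lambda>i. rep (x ^ i)) hyperplane_logs (rep ` {a. a - 1 \<in> V})"
    unfolding bij_betw_def
  proof
    show "inj_on (\<lambda>i. rep (x ^ i)) hyperplane_logs"
      by (auto simp: inj_on_def rep_eq_iff x_pow_cong_iff hyperplane_logs_def)
    have "rep a \<in> (\<lambda>i. rep (x ^ i)) ` hyperplane_logs" if a: "a - 1 \<in> V" for a
    proof -
      have "a \<notin> I"
        using V_diff[OF _ a, of a] V(2,3) by auto
      then obtain i where i: "i < m" "a - x ^ i \<in> I" using x_cover by blast
      then have "x ^ i - 1 \<in> V" using affine_saturated[OF a I_minus] by blast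
      then show ?thesis using i by (auto simp: hyperplane_logs_def rep_eq_iff)
    qed
    then show "(\<lambda>i. rep (x ^ i)) ` hyperplane_logs = rep ` {a. a - 1 \<in> V}"
      by (auto simp: hyperplane_logs_def)
  qed
  then show ?thesis using card_rep_affine bij_betw_same_card by metis
qed

text \<open>For \<open>c\<close> outside \<open>K\<close> the two affine hyperplanes are not
  parallel, so their intersection has codimension one in \<open>1 + V\<close>. The factor
  \<open>q\<close> is gained by translating it along a transversal \<open>y\<close> in
  \<open>V\<close>.\<close>

lemma card_affine_Int_le:
  assumes c: "c \<notin> K"
  shows "card (rep ` {a. a - 1 \<in> V \<and> c * a - 1 \<in> V}) * q \<le> card (rep ` V)"
proof -
  define B where "B = {a. a - 1 \<in> V \<and> c * a - 1 \<in> V}"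
  have B_saturated: "b \<in> B" if "a \<in> B" "b - a \<in> I" for a b
  proof -
    have "c * b - c * a \<in> I" using I_mult[OF that(2), of c] by (simp add: algebra_simps)
    then show ?thesis using that affine_saturated unfolding B_def by blast
  qed
  \<comment> \<open>Suppose \<open>V\<close> were stable under \<open>c\<close>. Pick
    \<open>a\<close> in \<open>K\<close> with \<open>c - a\<close> in \<open>V\<close>; splitting
    the inverse of \<open>c - a\<close> into its \<open>V\<close> and \<open>K\<close> parts and
    multiplying back by \<open>c - a\<close> would put 1 into \<open>V\<close>.\<close>
  have "\<exists>v\<in>V. c * v \<notin> V"
  proof (rule ccontr)
    assume neg: "\<not> ?thesis"
    obtain a where a: "a \<in> K" "c - a \<in> V" using decompose by blast
    have "c - a \<notin> I" using K_saturated[OF a(1)] c by blast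
    then have inv: "(c - a) ^ m - 1 \<in> I" by (rule power_m)
    obtain k where k: "k \<in> K" "(c - a) ^ (m - 1) - k \<in> V" using decompose by blast
    define v where "v = (c - a) ^ (m - 1) - k"
    have "(c - a) ^ m = (c - a) ^ (m - 1) * (c - a)" using m_pos by (simp only: power_minus_mult)
    then have "(c - a) ^ m = c * v - a * v + k * (c - a)" by (simp add: v_def algebra_simps)
    also have "\<dots> \<in> V"
    proof (intro V_add V_diff)
      show "c * v \<in> V" using neg k(2) by (simp add: v_def)
      show "a * v \<in> V" using V_mult[OF a(1) k(2)] by (simp add: v_def)
      show "k * (c - a) \<in> V" by (rule V_mult[OF k(1) a(2)])
    qed
    finally have "(c - a) ^ m - ((c - a) ^ m - 1) \<in> V" using V_diff V(2) inv by blast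
    then show False using V(3) by simp
  qed
  then obtain v where v: "v \<in> V" "c * v \<notin> V" by blast
  then obtain w k where wk: "w \<in> V" "k \<in> K" "1 = w + k * (c * v)" using V_max by blast
  \<comment> \<open>Scaling by \<open>k\<close> normalizes the direction: \<open>c * y\<close> is
    congruent to 1 modulo \<open>V\<close>.\<close>
  define y where "y = k * v"
  have y: "y \<in> V" "1 - c * y \<in> V"
  proof -
    show "y \<in> V" unfolding y_def by (intro V_mult wk v)
    have "1 - c * y = w" using wk(3) by (simp add: y_def algebra_simps)
    then show "1 - c * y \<in> V" using wk(1) by simp
  qed
  txt \<open>The map \<open>(b, k) \<mapsto> b + k * y\<close> is injective because multiplying by \<open>c\<close> and reducing modulo \<open>V\<close>
    yields \<open>1 + k\<close>.\<close>
  have "card (rep ` B \<times> rep ` K) \<le> card (rep ` {a. a - 1 \<in> V})"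
  proof (rule card_inj_on_le)
    show "finite (rep ` {a. a - 1 \<in> V})" by (rule finite_rep_image)
    show "(\<lambda>(b, k). rep (b + k * y)) ` (rep ` B \<times> rep ` K) \<subseteq> rep ` {a. a - 1 \<in> V}"
    proof clarsimp
      fix b k assume "b \<in> B" "k \<in> K"
      then have *: "rep b \<in> B" "rep k \<in> K" using B_saturated K_saturated rep by blast+
      have "rep b + rep k * y - 1 = (rep b - 1) + rep k * y" by simp
      also have "\<dots> \<in> V" using * y by (intro V_add V_mult) (auto simp: B_def)
      finally show "rep (rep b + rep k * y) \<in> rep ` {a. a - 1 \<in> V}" by blast
    qed
    show "inj_on (\<lambda>(b, k). rep (b + k * y)) (rep ` B \<times> rep ` K)"
    proof (rule inj_onI, clarsimp)
      fix b0 k0 b0' k0' assume *: "b0 \<in> B" "k0 \<in> K" "b0' \<in> B" "k0' \<in> K"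
        and eq: "rep (rep b0 + rep k0 * y) = rep (rep b0' + rep k0' * y)"
      define b k b' k' where bk: "b = rep b0" "k = rep k0" "b' = rep b0'" "k' = rep k0'"
      have in_sets: "b \<in> B" "k \<in> K" "b' \<in> B" "k' \<in> K"
        using * rep K_saturated B_saturated by (auto simp: bk)
      have sum: "b + k * y - (b' + k' * y) \<in> I" using eq by (simp add: rep_eq_iff bk)
      have "k - k' = c * (b + k * y - (b' + k' * y)) - ((c * b - 1) - (c * b' - 1))
          + (k - k') * (1 - c * y)" by (simp add: algebra_simps)
      also have "\<dots> \<in> V"
      proof (rule V_add, rule V_diff)
        show "c * (b + k * y - (b' + k' * y)) \<in> V" using I_mult[OF sum] V(2) by blast
        show "(c * b - 1) - (c * b' - 1) \<in> V"
          by (rule V_diff) (use in_sets in \<open>auto simp: B_def\<close>)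
        show "(k - k') * (1 - c * y) \<in> V" by (intro V_mult K_diff in_sets y)
      qed
      finally have kk: "k - k' \<in> I" using K_Int_V K_diff in_sets by blast
      have "b - b' = (b + k * y - (b' + k' * y)) - y * (k - k')" by (simp add: algebra_simps)
      also have "\<dots> \<in> I" using sum I_mult[OF kk] by (rule I_diff)
      finally have bb: "b - b' \<in> I" .
      show "rep b0 = rep b0' \<and> rep k0 = rep k0'"
        using bb kk rep_eq_iff rep_rep unfolding bk by metis
    qed
  qed
  then show ?thesis
    by (simp add: card_cartesian_product card_rep_K card_rep_affine B_def)
qed

text \<open>For \<open>c\<close> in \<open>K\<close> the hyperplanes are parallel: a common point
  would put \<open>c - 1\<close> into both \<open>K\<close> and \<open>V\<close>.\<close>

lemma affine_Int_empty:
  assumes c: "c \<in> K" "c - 1 \<notin> I" and a: "a - 1 \<in> V" "c * a - 1 \<in> V"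
  shows False
proof -
  have "c - 1 = (c * a - 1) - c * (a - 1)" by (simp add: algebra_simps)
  also have "\<dots> \<in> V" by (intro V_diff V_mult a c)
  finally show False using K_Int_V K_diff c K(3) by blast
qed

lemma hyperplane_logs_shift:
  assumes "i \<in> hyperplane_logs" "j \<in> hyperplane_logs" "i mod m = (j + t) mod m"
  shows "x ^ j - 1 \<in> V" "x ^ t * x ^ j - 1 \<in> V"
proof -
  show "x ^ j - 1 \<in> V" using assms by (simp add: hyperplane_logs_def)
  have "x ^ t * x ^ j - x ^ i \<in> I"
    using assms(3) by (simp add: power_add[symmetric] x_pow_cong_iff add.commute)
  then show "x ^ t * x ^ j - 1 \<in> V"
    using affine_saturated assms(1) by (auto simp: hyperplane_logs_def)
qed

text \<open>A pair with difference \<open>t\<close> is determined by \<open>j\<close>, and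
  \<open>x ^ j\<close> lies in the intersection of the affine hyperplanes belonging to
  \<open>c = x ^ t\<close>.\<close>

lemma card_hyperplane_logs_diff_le:
  assumes t: "\<not> m dvd t"
  shows "card {(i, j). i \<in> hyperplane_logs \<and> j \<in> hyperplane_logs \<and> i mod m = (j + t) mod m} * q
    \<le> card (rep ` V)"
proof (cases "x ^ t \<in> K")
  case True
  have empty: "{(i, j). i \<in> hyperplane_logs \<and> j \<in> hyperplane_logs \<and> i mod m = (j + t) mod m} = {}"
    using affine_Int_empty[OF True] t x_pow_eq_one_iff hyperplane_logs_shift by blast
  show ?thesis unfolding empty by simp
next
  case False
  have "card {(i, j). i \<in> hyperplane_logs \<and> j \<in> hyperplane_logs \<and> i mod m = (j + t) mod m}
    \<le> card (rep ` {a. a - 1 \<in> V \<and> x ^ t * a - 1 \<in> V})"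
  proof (rule card_inj_on_le)
    show "inj_on (\<lambda>(i, j). rep (x ^ j))
      {(i, j). i \<in> hyperplane_logs \<and> j \<in> hyperplane_logs \<and> i mod m = (j + t) mod m}"
      by (auto simp: inj_on_def rep_eq_iff x_pow_cong_iff hyperplane_logs_def)
    show "(\<lambda>(i, j). rep (x ^ j)) `
      {(i, j). i \<in> hyperplane_logs \<and> j \<in> hyperplane_logs \<and> i mod m = (j + t) mod m}
      \<subseteq> rep ` {a. a - 1 \<in> V \<and> x ^ t * a - 1 \<in> V}"
      using hyperplane_logs_shift by auto
  qed (rule finite_rep_image)
  then show ?thesis using card_affine_Int_le[OF False] by (meson le_trans mult_le_mono1)
qed

lemma hyperplane_logs_diff_empty:
  assumes "\<not> m dvd t" "m dvd t * (q - 1)" "i \<in> hyperplane_logs" "j \<in> hyperplane_logs"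
  shows "i mod m \<noteq> (j + t) mod m"
  using affine_Int_empty[of "x ^ t"] assms hyperplane_logs_shift
  by (metis x_pow_in_K_iff x_pow_eq_one_iff)

end

lemma exists_relative_difference_set:
  fixes q d :: nat
  assumes q: "primepow q" and d: "d \<ge> 2"
  defines "m \<equiv> q ^ d - 1"
  obtains A :: "nat set" where
    "A \<subseteq> {..<m}" "card A = q ^ (d - 1)"
    "\<And>t. \<not> m dvd t \<Longrightarrow> card {(i, j). i \<in> A \<and> j \<in> A \<and> i mod m = (j + t) mod m} \<le> q ^ (d - 2)"
    "\<And>t i j. \<not> m dvd t \<Longrightarrow> m dvd t * (q - 1) \<Longrightarrow> i \<in> A \<Longrightarrow> j \<in> A \<Longrightarrow> i mod m \<noteq> (j + t) mod m"
proof -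
  obtain p k where pk: "prime p" "k > 0" "q = p ^ k" using q by (auto simp: primepow_def)
  have q1: "q > 1" using q by (rule primepow_gt_Suc_0[unfolded One_nat_def[symmetric]])
  have qd: "q ^ d = p ^ (k * d)" by (simp add: pk(3) power_mult)
  have "k * d > 0" using pk(2) d by simp
  have "q ^ d > 1" using q1 d by (intro one_less_power) auto
  then have m: "m > 0" "Suc m = q ^ d" by (auto simp: m_def)
  obtain I :: "int poly set" and x where
    I: "submod UNIV I" "1 \<notin> I" "of_nat p \<in> I" "x ^ m - 1 \<in> I"
      "\<And>i. 0 < i \<Longrightarrow> i < m \<Longrightarrow> x ^ i - 1 \<notin> I" "\<And>a. a \<notin> I \<Longrightarrow> \<exists>i<m. a - x ^ i \<in> I"
    unfolding m_def qd by (rule exists_cyclic_residue_field[OF pk(1) \<open>k * d > 0\<close>]) blast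
  define K where "K = {a. a ^ q - a \<in> I}"
  note K = frobenius_fixed_ring[OF I(1) pk(1) I(3), where k = k, folded pk(3), folded K_def]
  have KI: "submod K I" using I(1) by (auto simp: submod_def)
  obtain V where V: "submod K V" "I \<subseteq> V" "1 \<notin> V"
    "\<And>y. y \<notin> V \<Longrightarrow> \<exists>v\<in>V. \<exists>k\<in>K. 1 = v + k * y"
    by (rule exists_maximal_submod[OF KI I(2) K(2,3,5,6)]) blast+
  have "q - 1 dvd m"
  proof -
    have "int (q ^ d - 1) = (int q - 1) * (\<Sum>i<d. int q ^ i)"
      using q1 by (simp add: of_nat_diff power_diff_1_eq[symmetric])
    then have "int (q - 1) dvd int m" using q1 by (simp add: m_def of_nat_diff)
    then show ?thesis by (simp only: int_dvd_int_iff)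
  qed
  interpret residue_subfield I x m q K V
    by unfold_locales (use I m q1 K V \<open>q - 1 dvd m\<close> in \<open>auto simp: K_def\<close>)
  have qV: "card (rep ` V) = q ^ (d - 1)"
  proof -
    have "card (rep ` V) * q = q ^ (d - 1) * q" using card_rep_V m(2) d power_minus_mult[of d q] by simp
    then show ?thesis using q1 by simp
  qed
  have qd2: "q ^ (d - 1) = q ^ (d - 2) * q"
    using d power_minus_mult[of "d - 1" q] by (simp add: numeral_2_eq_2)
  show thesis
  proof (rule that[of hyperplane_logs])
    show "hyperplane_logs \<subseteq> {..<m}" by (auto simp: hyperplane_logs_def)
    show "card hyperplane_logs = q ^ (d - 1)" by (simp add: card_hyperplane_logs qV)
    show "card {(i, j). i \<in> hyperplane_logs \<and> j \<in> hyperplane_logs \<and> i mod m = (j + t) mod m}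
      \<le> q ^ (d - 2)" if "\<not> m dvd t" for t
      using card_hyperplane_logs_diff_le[OF that] q1 unfolding qV qd2 by simp
  qed (rule hyperplane_logs_diff_empty)
qed

subsection \<open>Reduction of discrete logarithms\<close>

text \<open>Each new element that fails to enlarge the image creates at least two ordered
  collisions. This is the source of the factor 1/2 in the bound on the number of marks.\<close>

lemma card_image_collisions:
  assumes "finite A"
  shows "2 * card A \<le> 2 * card (f ` A) + card {(a, b). a \<in> A \<and> b \<in> A \<and> a \<noteq> b \<and> f a = f b}"
  using assms
proof (induction A rule: finite_induct)
  case empty
  then show ?case by simp
next
  case (insert x A)
  define C where "C A = {(a, b). a \<in> A \<and> b \<in> A \<and> a \<noteq> b \<and> f a = f b}" for A
  have fin: "finite (C B)" if "finite B" for B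
    by (rule finite_subset[of _ "B \<times> B"]) (use that in \<open>auto simp: C_def\<close>)
  have IH: "2 * card A \<le> 2 * card (f ` A) + card (C A)" using insert.IH by (simp add: C_def)
  have "2 * card (insert x A) \<le> 2 * card (f ` insert x A) + card (C (insert x A))"
  proof (cases "f x \<in> f ` A")
    case True
    then obtain y where y: "y \<in> A" "f y = f x" by force
    then have xy: "x \<noteq> y" "(x, y) \<notin> C A" "(y, x) \<notin> C A" using insert.hyps by (auto simp: C_def)
    have "insert (x, y) (insert (y, x) (C A)) \<subseteq> C (insert x A)"
      using y xy by (auto simp: C_def)
    then have "card (insert (x, y) (insert (y, x) (C A))) \<le> card (C (insert x A))"
      using insert.hyps by (intro card_mono fin) auto
    then have "Suc (Suc (card (C A))) \<le> card (C (insert x A))"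
      using xy fin[OF insert.hyps(1)] by simp
    then show ?thesis using IH True insert.hyps by (simp add: insert_absorb)
  next
    case False
    have "card (C A) \<le> card (C (insert x A))"
      using insert.hyps by (intro card_mono fin) (auto simp: C_def)
    then show ?thesis using IH False insert.hyps by simp
  qed
  then show ?case by (simp add: C_def)
qed

lemma card_UN_le_const:
  assumes "finite I" "\<And>i. i \<in> I \<Longrightarrow> card (A i) \<le> L"
  shows "card (\<Union>i\<in>I. A i) \<le> card I * L"
proof -
  have "card (\<Union>i\<in>I. A i) \<le> (\<Sum>i\<in>I. card (A i))" by (rule card_UN_le[OF assms(1)])
  also have "\<dots> \<le> (\<Sum>i\<in>I. L)" by (rule sum_mono) (rule assms(2))
  finally show ?thesis by simp
qed

text \<open>The multiples of \<open>\<eta> / gcd \<eta> c\<close> satisfy the divisibility, and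
  \<open>gcd \<eta> c\<close> of them lie below \<open>\<eta>\<close>. For \<open>c = q - 1\<close>
  they correspond to the elements of \<open>K\<close> in the subgroup of order
  \<open>\<eta>\<close>.\<close>

lemma card_multiples_le:
  fixes \<eta> c :: nat
  assumes "\<eta> > 0"
  shows "card {l. l < \<eta> \<and> \<not> \<eta> dvd l * c} \<le> \<eta> - gcd \<eta> c"
proof -
  define \<rho> where "\<rho> = gcd \<eta> c"
  obtain h where h: "\<eta> = \<rho> * h" unfolding \<rho>_def by (meson dvdE gcd_dvd1)
  obtain e where e: "c = \<rho> * e" unfolding \<rho>_def by (meson dvdE gcd_dvd2)
  have pos: "h > 0" "\<rho> > 0" using assms h by auto
  have "\<eta> dvd j * h * c" for j
  proof -
    have "j * h * c = \<eta> * (j * e)" unfolding e h by (simp add: ac_simps)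
    then show ?thesis by (rule dvdI)
  qed
  then have "{l. l < \<eta> \<and> \<not> \<eta> dvd l * c} \<subseteq> {..<\<eta>} - (\<lambda>j. j * h) ` {..<\<rho>}"
    by auto
  then have "card {l. l < \<eta> \<and> \<not> \<eta> dvd l * c} \<le> card ({..<\<eta>} - (\<lambda>j. j * h) ` {..<\<rho>})"
    by (intro card_mono) auto
  also have "\<dots> = \<eta> - card ((\<lambda>j. j * h) ` {..<\<rho>})"
    using pos by (subst card_Diff_subset) (auto simp: h)
  also have "card ((\<lambda>j. j * h) ` {..<\<rho>}) = \<rho>"
    using pos by (subst card_image) (auto simp: inj_on_def)
  finally show ?thesis by (simp add: \<rho>_def)
qed

text \<open>A nonzero residue \<open>r\<close> modulo \<open>N\<close> lifts to
  \<open>\<eta>\<close> residues \<open>r + l * N\<close> modulo \<open>m\<close>, each a difference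
  at most \<open>L\<close> times. Colliding elements differ by some \<open>l * N\<close> with
  \<open>l \<noteq> 0\<close>, and \<open>diff_empty\<close> excludes
  \<open>\<eta> dvd l * c\<close>. In the application \<open>c = q - 1\<close>.\<close>

lemma modular_ruler_of_difference_set:
  fixes A :: "nat set" and \<eta> L N c :: nat
  assumes pos: "\<eta> > 0" "N > 0"
  defines "m \<equiv> \<eta> * N"
  assumes A: "A \<subseteq> {..<m}"
    and diff: "\<And>t. \<not> m dvd t \<Longrightarrow> card {(i, j). i \<in> A \<and> j \<in> A \<and> i mod m = (j + t) mod m} \<le> L"
    and diff_empty: "\<And>t i j. \<not> m dvd t \<Longrightarrow> m dvd t * c \<Longrightarrow> i \<in> A \<Longrightarrow> j \<in> A \<Longrightarrow> i mod m \<noteq> (j + t) mod m"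
  obtains B where "modular_golomb_ruler (\<eta> * L) N B"
    "2 * card A \<le> 2 * card B + (\<eta> - gcd \<eta> c) * L"
proof -
  define D where "D t = {(i, j). i \<in> A \<and> j \<in> A \<and> i mod m = (j + t) mod m}" for t
  have m: "m > 0" using pos by (simp add: m_def)
  have finA: "finite A" using A finite_subset by blast
  have finD: "finite (D t)" for t
    by (rule finite_subset[of _ "A \<times> A"]) (use finA in \<open>auto simp: D_def\<close>)
  have in_D: "\<exists>l<\<eta>. (i, j) \<in> D (r + l * N)"
    if ij: "i \<in> A" "j \<in> A" "i mod N = (j + r) mod N" and r: "r < N" for i j r
  proof -
    have lt: "i < m" "j < m" using ij A by auto
    \<comment> \<open>The difference of \<open>i\<close> and \<open>j\<close> modulo
      \<open>m\<close>; adding \<open>m\<close> first avoids truncated subtraction. The required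
      \<open>l\<close> is \<open>t div N\<close>.\<close>
    define t where "t = (i + m - j) mod m"
    have t: "t < m" using m by (simp add: t_def)
    have "(j + t) mod m = (j + (i + m - j)) mod m" unfolding t_def by (rule mod_add_right_eq)
    also have "\<dots> = i mod m" using lt by simp
    finally have jt: "i mod m = (j + t) mod m" by simp
    have "N dvd m" by (simp add: m_def)
    then have "i mod N = (j + t) mod N" using jt by (metis mod_mod_cancel)
    then have "[j + t = j + r] (mod N)" using ij(3) by (simp add: cong_def)
    then have "[t = r] (mod N)" by (simp add: cong_add_lcancel_nat)
    then have "t mod N = r" using r by (simp add: cong_def)
    then have tr: "t = r + t div N * N" by (metis mod_div_mult_eq add.commute)
    have "t div N < \<eta>" using t by (simp add: m_def less_mult_imp_div_less)
    moreover have "(i, j) \<in> D (r + t div N * N)"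
      unfolding tr[symmetric] using ij jt by (simp add: D_def)
    ultimately show ?thesis by blast
  qed
  define f where "f i = int (i mod N)" for i
  define B where "B = f ` A"
  have "modular_golomb_ruler (\<eta> * L) N B"
    unfolding modular_golomb_ruler_def
  proof (intro conjI ballI)
    show "B \<subseteq> {0..<int N}" using pos by (auto simp: B_def f_def)
    fix r assume r: "r \<in> {1..<int N}"
    define P where "P = {(a, a'). a \<in> B \<and> a' \<in> B \<and> a \<noteq> a' \<and> [a - a' = r] (mod int N)}"
    \<comment> \<open>Choosing one preimage per residue embeds pairs from \<open>B\<close> into
      pairs from \<open>A\<close>.\<close>
    define s where "s = inv_into A f"
    have s: "s a \<in> A" "f (s a) = a" if "a \<in> B" for a
      using that unfolding B_def s_def by (auto intro: inv_into_into f_inv_into_f)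
    have "card P \<le> card (\<Union>l\<in>{..<\<eta>}. D (nat r + l * N))"
    proof (rule card_inj_on_le)
      show "inj_on (\<lambda>(a, a'). (s a, s a')) P"
        unfolding inj_on_def P_def using s(2) by clarsimp metis
      show "finite (\<Union>l\<in>{..<\<eta>}. D (nat r + l * N))" using finD by blast
      show "(\<lambda>(a, a'). (s a, s a')) ` P \<subseteq> (\<Union>l\<in>{..<\<eta>}. D (nat r + l * N))"
      proof clarsimp
        fix a a' assume "(a, a') \<in> P"
        then have a: "a \<in> B" "a' \<in> B" "[a - a' = r] (mod int N)" by (auto simp: P_def)
        have "[int (s a mod N) - int (s a' mod N) = r] (mod int N)"
          using a s unfolding f_def by metis
        then have "[int (s a) - int (s a') = r] (mod int N)"
          by (simp add: cong_def zmod_int mod_diff_eq)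
        then have "[int (s a) = int (s a') + r] (mod int N)"
          by (metis cong_add_lcancel cong_diff_iff_cong_0 diff_add_cancel add.commute)
        also have "int (s a') + r = int (s a' + nat r)" using r by simp
        finally have "s a mod N = (s a' + nat r) mod N"
          by (simp only: cong_def zmod_int[symmetric] of_nat_eq_iff)
        moreover have "nat r < N" using r by auto
        ultimately show "\<exists>l\<in>{..<\<eta>}. (s a, s a') \<in> D (nat r + l * N)"
          using in_D s a by blast
      qed
    qed
    also have "\<dots> \<le> card {..<\<eta>} * L"
    proof (rule card_UN_le_const)
      fix l assume "l \<in> {..<\<eta>}"
      then have "Suc l * N \<le> m" unfolding m_def by (intro mult_le_mono1) auto
      moreover have "0 < nat r" "nat r < N" using r by auto
      ultimately have "0 < nat r + l * N" "nat r + l * N < m" by simp_all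
      then have "\<not> m dvd nat r + l * N" by (simp add: nat_dvd_not_less)
      then show "card (D (nat r + l * N)) \<le> L" unfolding D_def by (rule diff)
    qed simp
    finally show "card P \<le> \<eta> * L" by simp
  qed
  moreover have "2 * card A \<le> 2 * card B + (\<eta> - gcd \<eta> c) * L"
  proof -
    define C where "C = {(i, j). i \<in> A \<and> j \<in> A \<and> i \<noteq> j \<and> f i = f j}"
    define T where "T = {l. l < \<eta> \<and> \<not> \<eta> dvd l * c}"
    have "C \<subseteq> (\<Union>l\<in>T. D (l * N))"
    proof clarsimp
      fix i j assume "(i, j) \<in> C"
      then have ij: "i \<in> A" "j \<in> A" "i \<noteq> j" "i mod N = (j + 0) mod N" by (auto simp: C_def f_def)
      from in_D[OF ij(1,2,4) pos(2)] obtain l where l: "l < \<eta>" "(i, j) \<in> D (l * N)" by auto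
      have lt: "i < m" "j < m" using ij A by auto
      have "l \<noteq> 0" using l(2) lt ij(3) by (cases l) (auto simp: D_def)
      then have ndvd: "\<not> m dvd l * N" using l(1) pos by (auto simp: m_def dest: dvd_imp_le)
      have "\<not> \<eta> dvd l * c"
      proof
        assume "\<eta> dvd l * c"
        then have "\<eta> * N dvd l * c * N" by (rule mult_dvd_mono) simp
        then have "m dvd l * N * c" by (simp add: m_def ac_simps)
        then show False using diff_empty[OF ndvd _ ij(1,2)] l(2) by (auto simp: D_def)
      qed
      then show "\<exists>l\<in>T. (i, j) \<in> D (l * N)" using l by (auto simp: T_def)
    qed
    moreover have "finite T" by (simp add: T_def)
    ultimately have "card C \<le> card (\<Union>l\<in>T. D (l * N))" using finD by (intro card_mono) auto
    also have "\<dots> \<le> card T * L"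
    proof (rule card_UN_le_const)
      fix l assume l: "l \<in> T"
      then have "l \<noteq> 0" by (auto simp: T_def intro: ccontr)
      then have "\<not> m dvd l * N" using l pos by (auto simp: m_def T_def dest: dvd_imp_le)
      then show "card (D (l * N)) \<le> L" unfolding D_def by (rule diff)
    qed fact
    also have "\<dots> \<le> (\<eta> - gcd \<eta> c) * L"
      unfolding T_def by (intro mult_le_mono1 card_multiples_le pos)
    finally have "card C \<le> (\<eta> - gcd \<eta> c) * L" .
    moreover have "2 * card A \<le> 2 * card B + card C"
      unfolding B_def C_def by (rule card_image_collisions[OF finA])
    ultimately show ?thesis by linarith
  qed
  ultimately show thesis by (rule that)
qed

subsection \<open>Cutting a modular ruler at its largest gap\<close>

text \<open>Truncate \<open>h\<close> at \<open>a\<close>. Raising \<open>a\<close> by one adds 1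
  for every \<open>s\<close> with \<open>h s > a\<close>, which excludes at most
  \<open>(a + 1) * g\<close> elements. Everything is doubled and rearranged to stay within the
  naturals.\<close>

lemma sum_ge_of_bounded_fibers:
  fixes h :: "'b \<Rightarrow> nat" and a g :: nat
  assumes "finite S" "\<And>v. card {s \<in> S. h s = v} \<le> g"
  shows "2 * a * card S \<le> 2 * (\<Sum>s\<in>S. h s) + g * a * (a + 1)"
proof -
  have "2 * a * card S \<le> 2 * (\<Sum>s\<in>S. min (h s) a) + g * a * (a + 1)"
  proof (induction a)
    case 0
    then show ?case by simp
  next
    case (Suc a)
    have "{s \<in> S. h s \<le> a} = (\<Union>v\<in>{..a}. {s \<in> S. h s = v})" by auto
    then have low: "card {s \<in> S. h s \<le> a} \<le> Suc a * g"
      using card_UN_le_const[of "{..a}" "\<lambda>v. {s \<in> S. h s = v}" g] assms by simp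
    have "(\<Sum>s\<in>S. min (h s) (Suc a)) = (\<Sum>s\<in>S. min (h s) a + (if \<not> h s \<le> a then 1 else 0))"
      by (rule sum.cong) auto
    also have "\<dots> = (\<Sum>s\<in>S. min (h s) a) + card {s \<in> S. \<not> h s \<le> a}"
      using assms(1) by (simp add: sum.distrib sum.If_cases Collect_conj_eq Int_commute)
    finally have step: "(\<Sum>s\<in>S. min (h s) (Suc a)) = (\<Sum>s\<in>S. min (h s) a) + card {s \<in> S. \<not> h s \<le> a}" .
    have "card S = card ({s \<in> S. h s \<le> a} \<union> {s \<in> S. \<not> h s \<le> a})"
      by (rule arg_cong[of _ _ card]) auto
    also have "\<dots> = card {s \<in> S. h s \<le> a} + card {s \<in> S. \<not> h s \<le> a}"
      using assms(1) by (intro card_Un_disjoint) auto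
    finally have "card S \<le> Suc a * g + card {s \<in> S. \<not> h s \<le> a}" using low by linarith
    then show ?case using Suc step by (simp add: algebra_simps)
  qed
  also have "\<dots> \<le> 2 * (\<Sum>s\<in>S. h s) + g * a * (a + 1)"
    by (intro add_right_mono mult_left_mono sum_mono) auto
  finally show ?thesis .
qed

text \<open>\<open>short\<close> makes reduction modulo \<open>N\<close> injective on
  \<open>S\<close> and confines its differences to values below \<open>N\<close>.\<close>

lemma golomb_ruler_of_modular:
  assumes A: "modular_golomb_ruler g N A" and S: "finite S"
    and mod: "\<And>s. s \<in> S \<Longrightarrow> s mod int N \<in> A"
    and short: "\<And>s t. s \<in> S \<Longrightarrow> t \<in> S \<Longrightarrow> t - s < int N"
  shows "golomb_ruler g S"
  unfolding golomb_ruler_def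
proof (intro conjI allI impI S)
  fix \<delta> :: int assume \<delta>: "\<delta> > 0"
  define P where "P = {(a, c). a \<in> S \<and> c \<in> S \<and> c - a = \<delta>}"
  show "card P \<le> g"
  proof (cases "\<delta> < int N")
    case False
    then have "P = {}" using short by (force simp: P_def)
    then show ?thesis by simp
  next
    case True
    have inj: "s = t" if "s \<in> S" "t \<in> S" "s mod int N = t mod int N" for s t
    proof -
      have "int N dvd s - t" using that(3) by (simp add: mod_eq_dvd_iff)
      moreover have "\<bar>s - t\<bar> < int N" using short[OF that(1,2)] short[OF that(2,1)] by linarith
      ultimately show ?thesis using zdvd_imp_le[of "int N" "\<bar>s - t\<bar>"] by (cases "s = t") auto
    qed
    define R where "R = {(a, a'). a \<in> A \<and> a' \<in> A \<and> a \<noteq> a' \<and> [a - a' = \<delta>] (mod int N)}"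
    have "finite A" using A finite_subset unfolding modular_golomb_ruler_def by blast
    then have "finite R" by (intro finite_subset[of R "A \<times> A"]) (auto simp: R_def)
    have "card P \<le> card R"
    proof (rule card_inj_on_le[OF _ _ \<open>finite R\<close>])
      \<comment> \<open>The components are swapped because the ruler counts \<open>c - a\<close> and
        the modular ruler counts \<open>a - a'\<close>.\<close>
      show "inj_on (\<lambda>(a, c). (c mod int N, a mod int N)) P"
        unfolding inj_on_def P_def using inj by auto
      show "(\<lambda>(a, c). (c mod int N, a mod int N)) ` P \<subseteq> R"
      proof clarsimp
        fix a c assume "(a, c) \<in> P"
        then have ac: "a \<in> S" "c \<in> S" "c - a = \<delta>" by (auto simp: P_def)
        have "c mod int N \<noteq> a mod int N" using inj[OF ac(2,1)] ac(3) \<delta> by auto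
        moreover have "[c mod int N - a mod int N = \<delta>] (mod int N)"
          using ac(3) by (simp add: cong_def mod_diff_eq)
        ultimately show "(c mod int N, a mod int N) \<in> R" using ac mod by (simp add: R_def)
      qed
    qed
    also have "\<dots> \<le> g"
      using A \<delta> True unfolding modular_golomb_ruler_def R_def by auto
    finally show ?thesis .
  qed
qed

text \<open>\<open>M\<close> is the largest cyclic gap of an \<open>n\<close>-element subset. The
  deficits of the gaps from \<open>M\<close> sum to \<open>n * M - N\<close> with each value taken
  at most \<open>g\<close> times, so \<open>sum_ge_of_bounded_fibers\<close> applies for every
  \<open>a\<close>.\<close>

lemma exists_large_gap_ruler:
  assumes A: "modular_golomb_ruler g N A" and g: "g > 0"
    and n: "0 < n" "n \<le> card A"
  obtains M :: int where
    "\<exists>S. golomb_ruler g S \<and> card S = n \<and> Max S - Min S = int N - M" "M \<le> int N"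
    "\<And>a. 2 * int a * int n \<le> 2 * (int n * M - int N) + int g * int a * (int a + 1)"
proof -
  have A_range: "A \<subseteq> {0..<int N}"
    and A_diff: "\<And>r. r \<in> {1..<int N} \<Longrightarrow>
        card {(a, a'). a \<in> A \<and> a' \<in> A \<and> a \<noteq> a' \<and> [a - a' = r] (mod int N)} \<le> g"
    using A by (auto simp: modular_golomb_ruler_def)
  have finA: "finite A" using A_range finite_subset by blast
  obtain B where B: "B \<subseteq> A" "card B = n" using n obtain_subset_with_card_n by blast
  have finB: "finite B" using B finA finite_subset by blast
  define xs where "xs = sorted_list_of_set B"
  have xs: "set xs = B" "length xs = n" "sorted_wrt (<) xs" "distinct xs"
    using finB B by (auto simp: xs_def)
  have less: "xs ! i < xs ! j" if "i < j" "j < n" for i j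
    using xs(3) that xs(2) by (simp add: sorted_wrt_iff_nth_less)
  have less_eq: "xs ! i \<le> xs ! j" if "i \<le> j" "j < n" for i j
    using less[of i j] that by (cases "i = j") auto
  have range: "0 \<le> xs ! i" "xs ! i < int N" "xs ! i \<in> A" if "i < n" for i
  proof -
    show "xs ! i \<in> A" using that xs(1,2) B(1) nth_mem by blast
    then show "0 \<le> xs ! i" "xs ! i < int N" using A_range by auto
  qed
  define \<gamma> where "\<gamma> i = (if Suc i < n then xs ! Suc i else xs ! 0 + int N) - xs ! i" for i
  have sum: "(\<Sum>i<n. \<gamma> i) = int N"
  proof -
    obtain k where k: "n = Suc k" using n(1) gr0_implies_Suc by blast
    have "(\<Sum>i<k. \<gamma> i) = (\<Sum>i<k. xs ! Suc i - xs ! i)"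
      by (rule sum.cong) (auto simp: \<gamma>_def k)
    also have "\<dots> = xs ! k - xs ! 0" by (rule sum_lessThan_telescope)
    finally show ?thesis by (simp add: k \<gamma>_def)
  qed
  have gap_pos: "\<gamma> i > 0" if "i < n" for i
    using less[of i "Suc i"] range[OF that] range[OF n(1)] by (auto simp: \<gamma>_def)
  have gap_fiber: "card {i \<in> {..<n}. \<gamma> i = v} \<le> g" for v
  proof (cases "n = 1")
    \<comment> \<open>The only gap is \<open>N\<close> itself, which is zero modulo
      \<open>N\<close>, so the modular condition says nothing about it; \<open>g > 0\<close>
      suffices.\<close>
    case True
    have "card {i \<in> {..<n}. \<gamma> i = v} \<le> card {..<n}" by (intro card_mono) auto
    then show ?thesis using True g by simp
  next
    case False
    then have n2: "n \<ge> 2" using n by simp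
    define R where "R = {(a, a'). a \<in> A \<and> a' \<in> A \<and> a \<noteq> a' \<and> [a - a' = v] (mod int N)}"
    have "finite R" by (rule finite_subset[of R "A \<times> A"]) (use finA in \<open>auto simp: R_def\<close>)
    define nxt where "nxt i = (if Suc i < n then Suc i else 0)" for i
    have nxt: "nxt i < n" "nxt i \<noteq> i" if "i < n" for i using that n2 by (auto simp: nxt_def)
    have gap_lt: "\<gamma> i < int N" if "i < n" for i
    proof (cases "Suc i < n")
      case True
      then show ?thesis using range[OF True] range[OF that] by (simp add: \<gamma>_def)
    next
      case False
      then have "0 < i" using that n2 by simp
      then show ?thesis using False less[OF \<open>0 < i\<close> that] by (simp add: \<gamma>_def)
    qed
    show ?thesis
    proof (cases "v \<in> {1..<int N}")
      case False
      then have "{i \<in> {..<n}. \<gamma> i = v} = {}" using gap_pos gap_lt by force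
      then show ?thesis by (simp only: card.empty)
    next
      case True
      have "card {i \<in> {..<n}. \<gamma> i = v} \<le> card R"
      proof (rule card_inj_on_le[OF _ _ \<open>finite R\<close>])
        show "inj_on (\<lambda>i. (xs ! nxt i, xs ! i)) {i \<in> {..<n}. \<gamma> i = v}"
          using xs(2,4) by (auto simp: inj_on_def nth_eq_iff_index_eq)
        show "(\<lambda>i. (xs ! nxt i, xs ! i)) ` {i \<in> {..<n}. \<gamma> i = v} \<subseteq> R"
        proof clarsimp
          fix i assume i: "i < n" "v = \<gamma> i"
          have "xs ! nxt i \<noteq> xs ! i" using nxt[OF i(1)] i(1) xs(2,4) by (simp add: nth_eq_iff_index_eq)
          moreover have "xs ! nxt i - xs ! i = \<gamma> i - (if Suc i < n then 0 else int N)"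
            by (simp add: nxt_def \<gamma>_def)
          then have "[xs ! nxt i - xs ! i = \<gamma> i] (mod int N)"
            by (simp add: cong_iff_dvd_diff)
          ultimately show "(xs ! nxt i, xs ! i) \<in> R"
            using range(3) nxt(1)[OF i(1)] i by (simp add: R_def)
        qed
      qed
      then show ?thesis using A_diff[OF True] by (simp add: R_def)
    qed
  qed
  define M where "M = Max (\<gamma> ` {..<n})"
  have M_in: "M \<in> \<gamma> ` {..<n}" unfolding M_def using n(1) by (intro Max_in) auto
  then obtain i0 where i0: "i0 < n" "\<gamma> i0 = M" by auto
  have M_max: "\<gamma> i \<le> M" if "i < n" for i unfolding M_def using that by (intro Max_ge) auto
  define t where "t = xs ! i0"
  \<comment> \<open>Marks up to \<open>t\<close>, the lower end of the largest gap, are moved up one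
    full turn; the result runs from \<open>t + M\<close> to \<open>t + N\<close>.\<close>
  define \<phi> where "\<phi> b = (if b \<le> t then b + int N else b)" for b
  define S where "S = \<phi> ` B"
  have B_nth: "\<exists>j<n. b = xs ! j" if "b \<in> B" for b using that xs(1,2) by (metis in_set_conv_nth)
  have \<phi>_mod: "\<phi> b mod int N = b" if "b \<in> B" for b
    using that B(1) A_range by (auto simp: \<phi>_def)
  have cardS: "card S = n"
    unfolding S_def using B(2) \<phi>_mod by (subst card_image) (auto simp: inj_on_def, metis)
  have upper: "s \<le> t + int N" if "s \<in> S" for s
    using that B(1) A_range range[OF i0(1)] by (fastforce simp: S_def \<phi>_def t_def)
  have lower: "t + M \<le> s" if "s \<in> S" for s
  proof -
    from that obtain b where b: "b \<in> B" "s = \<phi> b" unfolding S_def by blast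
    from B_nth[OF b(1)] obtain j where j: "j < n" "b = xs ! j" by blast
    note j = j(1) b(2)[unfolded j(2)]
    show ?thesis
    proof (cases "Suc i0 < n")
      case True
      then have tM: "t + M = xs ! Suc i0" using i0(2) by (simp add: \<gamma>_def t_def)
      show ?thesis
      proof (cases "xs ! j \<le> t")
        case True
        then show ?thesis using j range[OF \<open>Suc i0 < n\<close>] range[OF j(1)] tM by (simp add: \<phi>_def)
      next
        case False
        then have "\<not> j \<le> i0" using less_eq[of j i0] i0(1) by (auto simp: t_def)
        then have "i0 < j" by simp
        then show ?thesis using less_eq[of "Suc i0" j] j tM False by (simp add: \<phi>_def)
      qed
    next
      case False
      then have "t + M = xs ! 0 + int N" using i0(2) by (simp add: \<gamma>_def t_def)
      moreover have "xs ! j \<le> t" using less_eq[of j i0] j i0(1) False by (simp add: t_def)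
      ultimately show ?thesis using j less_eq[of 0 j] by (simp add: \<phi>_def)
    qed
  qed
  have tB: "t \<in> B" using i0(1) xs(1,2) unfolding t_def by auto
  then have top: "t + int N \<in> S" by (force simp: S_def \<phi>_def)
  have bot: "t + M \<in> S"
  proof (cases "Suc i0 < n")
    case True
    then have "t + M = xs ! Suc i0" using i0(2) by (simp add: \<gamma>_def t_def)
    moreover have "\<phi> (xs ! Suc i0) = xs ! Suc i0" using less[of i0 "Suc i0"] True by (simp add: \<phi>_def t_def)
    moreover have "xs ! Suc i0 \<in> B" using True xs(1,2) by auto
    ultimately show ?thesis unfolding S_def by (metis imageI)
  next
    case False
    then have "t + M = xs ! 0 + int N" using i0(2) by (simp add: \<gamma>_def t_def)
    moreover have "\<phi> (xs ! 0) = xs ! 0 + int N" using less_eq[of 0 i0] i0(1) by (simp add: \<phi>_def t_def)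
    moreover have "xs ! 0 \<in> B" using n(1) xs(1,2) by auto
    ultimately show ?thesis unfolding S_def by (metis imageI)
  qed
  have finS: "finite S" using finB by (simp add: S_def)
  have "Max S = t + int N" using finS upper top by (intro Max_eqI) auto
  moreover have "Min S = t + M" using finS lower bot by (intro Min_eqI) auto
  ultimately have diam: "Max S - Min S = int N - M" by simp
  have Mpos: "M > 0" using gap_pos i0 by auto
  have "golomb_ruler g S"
  proof (rule golomb_ruler_of_modular[OF A finS])
    show "s mod int N \<in> A" if "s \<in> S" for s using that \<phi>_mod B(1) by (auto simp: S_def)
    show "v - u < int N" if "u \<in> S" "v \<in> S" for u v
      using upper[OF that(2)] lower[OF that(1)] Mpos by linarith
  qed
  moreover have "M \<le> int N" using upper[OF bot] by simp
  moreover have "2 * int a * int n \<le> 2 * (int n * M - int N) + int g * int a * (int a + 1)" for a :: nat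
  proof -
    define h where "h i = nat (M - \<gamma> i)" for i
    have "card {i \<in> {..<n}. h i = v} \<le> g" for v
    proof -
      have "{i \<in> {..<n}. h i = v} \<subseteq> {i \<in> {..<n}. \<gamma> i = M - int v}"
        using M_max by (auto simp: h_def)
      then have "card {i \<in> {..<n}. h i = v} \<le> card {i \<in> {..<n}. \<gamma> i = M - int v}"
        by (intro card_mono) auto
      then show ?thesis using gap_fiber le_trans by blast
    qed
    then have "2 * a * card {..<n} \<le> 2 * (\<Sum>i<n. h i) + g * a * (a + 1)"
      by (intro sum_ge_of_bounded_fibers) auto
    then have "int (2 * a * n) \<le> int (2 * (\<Sum>i<n. h i) + g * a * (a + 1))"
      by (simp only: card_lessThan of_nat_le_iff)
    moreover have "int (\<Sum>i<n. h i) = (\<Sum>i<n. M - \<gamma> i)"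
      unfolding of_nat_sum by (rule sum.cong) (auto simp: h_def M_max)
    moreover have "\<dots> = int n * M - int N" by (simp add: sum_subtractf sum)
    ultimately show ?thesis by (simp add: distrib_left)
  qed
  ultimately show thesis using that[of M] diam cardS by blast
qed

lemma min_diameter_le_of_modular:
  fixes a r :: int
  assumes A: "modular_golomb_ruler g N A" and g: "g > 0" and n: "0 < n" "n \<le> card A"
    and nar: "int n = a * int g + r" "0 \<le> r" "r < int g"
  shows "int (min_diameter g n) \<le>
    int N - \<lceil>(real N + real g * of_int a * (of_int a - 1) / 2 + of_int r * of_int a) / real n\<rceil>"
proof -
  obtain M where M: "\<exists>S. golomb_ruler g S \<and> card S = n \<and> Max S - Min S = int N - M" "M \<le> int N"
    "\<And>a. 2 * int a * int n \<le> 2 * (int n * M - int N) + int g * int a * (int a + 1)"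
    using exists_large_gap_ruler[OF A g n] by metis
  \<comment> \<open>The gap inequality is available for natural parameters only.\<close>
  have "a \<ge> 0"
  proof (rule ccontr)
    assume "\<not> a \<ge> 0"
    then have "a * int g \<le> - 1 * int g" by (intro mult_right_mono) auto
    then show False using nar n(1) by linarith
  qed
  then obtain b where b: "a = int b" using zero_le_imp_eq_int by blast
  have "2 * int b * int n \<le> 2 * (int n * M - int N) + int g * int b * (int b + 1)"
    using M(3)[of b] by simp
  \<comment> \<open>With \<open>n = a * g + r\<close>, the difference
    \<open>2 * a * n - g * a * (a + 1)\<close> becomes
    \<open>g * a * (a - 1) + 2 * r * a\<close>.\<close>
  then have "2 * int N + int g * a * (a - 1) + 2 * r * a \<le> 2 * (M * int n)"
    unfolding b[symmetric] by (simp add: nar(1) algebra_simps)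
  then have "real_of_int (2 * int N + int g * a * (a - 1) + 2 * r * a) \<le> real_of_int (2 * (M * int n))"
    by (simp only: of_int_le_iff)
  then have "real N + real g * of_int a * (of_int a - 1) / 2 + of_int r * of_int a \<le> of_int M * real n"
    by (simp add: field_simps)
  then have "\<lceil>(real N + real g * of_int a * (of_int a - 1) / 2 + of_int r * of_int a) / real n\<rceil> \<le> M"
    using n(1) by (simp add: ceiling_le_iff divide_le_eq)
  moreover have "min_diameter g n \<le> nat (int N - M)"
    unfolding min_diameter_def by (rule Least_le) (use M(1,2) in auto)
  ultimately show ?thesis using M(2) by linarith
qed

section \<open>Specialization to the affine difference set and its diameter bound\<close>

theorem theorem5:
  fixes q d g \<eta> \<rho> N :: nat
  assumes "primepow q" and "d \<ge> 2" and "g > 0"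
    and "q ^ (d - 2) dvd g"
  defines "\<eta> \<equiv> g div q ^ (d - 2)"
  assumes "\<eta> dvd q ^ d - 1"
  defines "\<rho> \<equiv> gcd \<eta> (q - 1)"
    and "N \<equiv> q ^ (d - 2) * (q ^ d - 1) div g"
  shows "(\<exists>A. modular_golomb_ruler g N A \<and>
            real (card A) \<ge> real (q ^ (d - 1)) - real (q ^ (d - 2)) * (real \<eta> - real \<rho>) / 2)
       \<and> (\<forall>(n::nat) (a::int) (r::int).
            n > 0 \<longrightarrow>
            real n \<le> real (q ^ (d - 1)) - real (q ^ (d - 2)) * (real \<eta> - real \<rho>) / 2 \<longrightarrow>
            int n = a * int g + r \<longrightarrow> 0 \<le> r \<longrightarrow> r < int g \<longrightarrow>
            int (min_diameter g n) \<le>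
              int N - \<lceil>(real N + real g * of_int a * (of_int a - 1) / 2 + of_int r * of_int a)
                        / real n\<rceil>)"
proof -
  define L where "L = q ^ (d - 2)"
  have q1: "q > 1" using assms(1) by (rule primepow_gt_Suc_0[unfolded One_nat_def[symmetric]])
  have L: "L > 0" using q1 by (simp add: L_def)
  have g: "g = \<eta> * L" using assms(4) by (simp add: \<eta>_def L_def)
  have \<eta>: "\<eta> > 0" using g \<open>g > 0\<close> by (cases \<eta>) auto
  have "q ^ d > 1" using q1 \<open>d \<ge> 2\<close> by (intro one_less_power) auto
  obtain N' where N': "q ^ d - 1 = \<eta> * N'" using \<open>\<eta> dvd q ^ d - 1\<close> by blast
  \<comment> \<open>The division in \<open>N\<close> is exact: \<open>L\<close> cancels and leaves
    the quotient of \<open>q ^ d - 1\<close> by \<open>\<eta>\<close>.\<close>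
  have "N = L * (\<eta> * N') div (\<eta> * L)" by (simp only: N_def g N' L_def[symmetric])
  also have "\<dots> = N' * (\<eta> * L) div (\<eta> * L)" by (simp only: ac_simps)
  also have "\<dots> = N'" using \<eta> L by simp
  finally have m: "q ^ d - 1 = \<eta> * N" using N' by simp
  then have N: "N > 0" using \<open>q ^ d > 1\<close> by (cases N) auto
  obtain A where A: "A \<subseteq> {..<\<eta> * N}" "card A = q ^ (d - 1)"
    "\<And>t. \<not> \<eta> * N dvd t \<Longrightarrow>
      card {(i, j). i \<in> A \<and> j \<in> A \<and> i mod (\<eta> * N) = (j + t) mod (\<eta> * N)} \<le> L"
    "\<And>t i j. \<not> \<eta> * N dvd t \<Longrightarrow> \<eta> * N dvd t * (q - 1) \<Longrightarrow> i \<in> A \<Longrightarrow> j \<in> A \<Longrightarrow>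
      i mod (\<eta> * N) \<noteq> (j + t) mod (\<eta> * N)"
    unfolding L_def m[symmetric] by (rule exists_relative_difference_set[OF assms(1,2)]) blast
  obtain B where B: "modular_golomb_ruler (\<eta> * L) N B"
    "2 * card A \<le> 2 * card B + (\<eta> - gcd \<eta> (q - 1)) * L"
    by (rule modular_ruler_of_difference_set[OF \<eta> N A(1,3,4)])
  have "\<rho> \<le> \<eta>" using \<eta> by (simp add: \<rho>_def gcd_le1_nat)
  have "real (2 * q ^ (d - 1)) \<le> real (2 * card B + (\<eta> - \<rho>) * L)"
    using B(2) unfolding A(2) \<rho>_def by (simp only: of_nat_le_iff)
  then have card_B: "real (card B) \<ge>
      real (q ^ (d - 1)) - real (q ^ (d - 2)) * (real \<eta> - real \<rho>) / 2"
    by (simp add: L_def of_nat_diff[OF \<open>\<rho> \<le> \<eta>\<close>] field_simps)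
  have ruler: "modular_golomb_ruler g N B" using B(1) g by simp
  show ?thesis
  proof (intro conjI allI impI)
    show "\<exists>A. modular_golomb_ruler g N A \<and>
        real (card A) \<ge> real (q ^ (d - 1)) - real (q ^ (d - 2)) * (real \<eta> - real \<rho>) / 2"
      using ruler card_B by blast
  next
    fix n :: nat and a r :: int
    assume n: "n > 0"
      "real n \<le> real (q ^ (d - 1)) - real (q ^ (d - 2)) * (real \<eta> - real \<rho>) / 2"
      and nar: "int n = a * int g + r" "0 \<le> r" "r < int g"
    have "n \<le> card B" using n(2) card_B by linarith
    then show "int (min_diameter g n) \<le> int N -
        \<lceil>(real N + real g * of_int a * (of_int a - 1) / 2 + of_int r * of_int a) / real n\<rceil>"
      using min_diameter_le_of_modular[OF ruler \<open>g > 0\<close> n(1) _ nar] by blast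
  qed
qed

end
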